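(* Let $\mathcal{X}$ be an action space with mean payoff function $f$, and suppose that Assumptions (A1), (A2), (A3) listed in the context hold for a semi-metric $\ell$ and constants $\nu_1,\nu_2>0$ and $0<\rho<1$. Let $d<+\infty$ be the $(4\nu_1/\nu_2,\nu_2)$-near-optimality dimension of $f$ with respect to $\ell$. Let $c>0$ be a constant. If, for horizon $n$, the depth limit $\hat H$ of the algorithm LD-HOO is selected so that $$\rho^{\hat H}=c\left(\frac{n}{\log n}\right)^{-\frac{1}{d+2}},$$ then $$\mathbb{E}[R_n]\in O\left(n^{\frac{d+1}{d+2}}(\log n)^{\frac{1}{d+2}}\right),$$ where the implied constant does not depend on $n$.
   Context: **Bandit problem.** At each time step $t=1,2,\ldots$ a decision maker selects a (possibly random) action $X_t\in\mathcal{X}$ and receives a random reward $Y_t\in[0,1]$. Given $X_t=x$, the reward $Y_t$ has mean $f(x)$; its distribution is stationary and independent of the past given $X_t$. The function $f:\mathcal{X}\to\mathbb{R}$ is unknown to the decision maker and attains its maximum at $x^*\in\mathcal{X}$. The regret considered is $R_n=nf(x^* )-\sum_{t=1}^n f(X_t)$. **Hierarchical partition.** $\mathcal{X}$ is split successively into cells $\mathcal{X}_{h,i}$, $h\ge 0$, $0\le i\le 2^h-1$, arranged as a binary tree: $\mathcal{X}_{0,0}=\mathcal{X}$, and each $\mathcal{X}_{h,i}$ is partitioned into its two children cells. The children of node $(h,i)$ are $\mathcal{C}(h,i)=\{(h+1,2i),(h+1,2i+1)\}$. **Assumptions.** (A1) $\mathcal{X}$ is equipped with a semi-metric $\ell:\mathcal{X}\times\mathcal{X}\to\mathbb{R}$: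 for all $x,x'$, $\ell(x,x')\ge0$, $\ell(x,x')=\ell(x',x)$, and $\ell(x,x')=0$ iff $x=x'$. Write $\mathrm{diam}(U)=\sup_{x,x'\in U}\ell(x,x')$ and $\mathcal{B}(x,\varepsilon)=\{x'\in\mathcal{X}:\ell(x,x')<\varepsilon\}$. (A2) There are constants $\nu_1,\nu_2>0$ and $0<\rho<1$ such that for all $h\ge0$ and $i\in\{0,\ldots,2^h-1\}$ there is $x_{h,i}\in\mathcal{X}_{h,i}$ with $\mathrm{diam}(\mathcal{X}_{h,i})\le\nu_1\rho^h$, $\mathcal{B}(x_{h,i},\nu_2\rho^h)\subset\mathcal{X}_{h,i}$, and $\mathcal{B}(x_{h,i},\nu_2\rho^h)\cap\mathcal{B}(x_{h,j},\nu_2\rho^h)=\emptyset$ for $i\ne j$. (A3) For all $x,x'\in\mathcal{X}$, $f(x^* )-f(x')\le f(x^* )-f(x)+\max\{f(x^* )-f(x),\ell(x,x')\}$. **Near-optimality dimension.** For $\varepsilon>0$ let $\mathcal{X}_\varepsilon=\{x\in\mathcal{X}: f(x)\ge f(x^* )-\varepsilon\}$. For a set $A\subset\mathcal{X}$, the $\varepsilon$-packing number $\mathcal{N}(A,\ell,\varepsilon)$ is the largest integer $K$ for which there are $x_1,\ldots,x_K\in A$ with $\mathcal{B}(x_k,\varepsilon)\subset A$ for all $k$ and the balls $\mathcal{B}(x_k,\varepsilon)$ pairwise disjoint. For $c_0>0,\varepsilon_0>0$, the $(c_0,\varepsilon_0)$-near-optimality dimension of $f$ with respect to $\ell$ is $$d=\inf\{\delta\ge0:\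 \exists C>0\ \text{s.t.}\ \forall\, 0<\varepsilon\le\varepsilon_0,\ \mathcal{N}(\mathcal{X}_{c_0\varepsilon},\ell,\varepsilon)\le C\varepsilon^{-\delta}\},\qquad \inf\emptyset=+\infty.$$ When $d<+\infty$ it is understood to be the smallest such value, i.e. there is $C>0$ with $\mathcal{N}(\mathcal{X}_{c_0\varepsilon},\ell,\varepsilon)\le C\varepsilon^{-d}$ for all $0<\varepsilon\le\varepsilon_0$. **Algorithm LD-HOO** (parameters $\nu_1,\rho$, depth limit $\hat H$, a positive integer). It maintains trees $\mathcal{T}_t$ of nodes, with $\mathcal{T}_1=\{(0,0)\}$. At round $t$ it selects a leaf $(h_t,i_t)$ of $\mathcal{T}_t$ and plays an arbitrary action $X_t\in\mathcal{X}_{h_t,i_t}$. Let $T_{h,i}(t)$ be the number of rounds $\tau\le t$ in which the selected node $(h_\tau,i_\tau)$ is $(h,i)$ or a descendant of $(h,i)$. At round $t$, let $T=T_{h,i}(t-1)$ be the count before the round, and let $\hat\mu$ be the average of the rewards $Y_\tau$ over the corresponding rounds $\tau\le t-1$. If $T>0$, then $$u_{h,i}(t)=\hat\mu+\sqrt{\frac{2\log t}{T}}+\nu_1\rho^h,$$ $$b_{h,i}(t)=\min\Big\{u_{h,i}(t),\max_{c'\in\mathcal{C}(h,i)}b_{c'}(t)\Big\}\ \text{ if } h<\hat H,\qquad b_{\hat H,i}(t)=u_{\hat H,i}(t).$$ If $T=0$, then $u_{h,i}(t)=b_{h,i}(t)=+\infty$. The leaf $(h_t,i_t)$ is found by starting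 at $(0,0)$ and repeatedly moving to a child with largest $b$-value (ties broken arbitrarily) until a leaf of $\mathcal{T}_t$ is reached. After $Y_t$ is observed, if $h_t<\hat H$ then $\mathcal{T}_{t+1}=\mathcal{T}_t\cup\mathcal{C}(h_t,i_t)$; otherwise $\mathcal{T}_{t+1}=\mathcal{T}_t$. **Convention.** The horizon $n\ge2$, so that $\log n>0$; $\hat H$ depends on $n$ through the displayed relation, while $c,\rho,\nu_1,\nu_2,d$ are fixed. *)

theory Defs
  imports "HOL-Probability.Probability"
begin

section \<open>Semi-metrics and near-optimality dimension\<close>

definition semimetric_on :: "'x set \<Rightarrow> ('x \<Rightarrow> 'x \<Rightarrow> real) \<Rightarrow> bool" where
  "semimetric_on S l \<longleftrightarrow>
     (\<forall>x\<in>S. \<forall>x'\<in>S. 0 \<le> l x x' \<and> l x x' = l x' x \<and> (l x x' = 0 \<longleftrightarrow> x = x'))"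

text \<open>The diameter is an extended real, so that unbounded sets have diameter \<open>\<infinity>\<close>.\<close>

definition semi_diam :: "('x \<Rightarrow> 'x \<Rightarrow> real) \<Rightarrow> 'x set \<Rightarrow> ereal" where
  "semi_diam l U = (SUP x\<in>U. SUP x'\<in>U. ereal (l x x'))"

definition semi_ball :: "'x set \<Rightarrow> ('x \<Rightarrow> 'x \<Rightarrow> real) \<Rightarrow> 'x \<Rightarrow> real \<Rightarrow> 'x set" where
  "semi_ball S l x \<epsilon> = {x'\<in>S. l x x' < \<epsilon>}"

text \<open>Packings of size \<open>K\<close> are indexed by \<open>k < K\<close>. The packing number is \<open>\<infinity>\<close> if there
  are arbitrarily large packings.\<close>

definition is_packing ::
    "'x set \<Rightarrow> ('x \<Rightarrow> 'x \<Rightarrow> real) \<Rightarrow> 'x set \<Rightarrow> real \<Rightarrow> nat \<Rightarrow> (nat \<Rightarrow> 'x) \<Rightarrow> bool" where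
  "is_packing S l U \<epsilon> K x \<longleftrightarrow>
     (\<forall>k<K. x k \<in> U \<and> semi_ball S l (x k) \<epsilon> \<subseteq> U) \<and>
     (\<forall>j<K. \<forall>k<K. j \<noteq> k \<longrightarrow> semi_ball S l (x j) \<epsilon> \<inter> semi_ball S l (x k) \<epsilon> = {})"

definition packing_number ::
    "'x set \<Rightarrow> ('x \<Rightarrow> 'x \<Rightarrow> real) \<Rightarrow> 'x set \<Rightarrow> real \<Rightarrow> ereal" where
  "packing_number S l U \<epsilon> = (SUP K\<in>{K. \<exists>x. is_packing S l U \<epsilon> K x}. ereal (real K))"

definition near_optimal :: "'x set \<Rightarrow> ('x \<Rightarrow> real) \<Rightarrow> 'x \<Rightarrow> real \<Rightarrow> 'x set" where
  "near_optimal S f xstar \<epsilon> = {x\<in>S. f x \<ge> f xstar - \<epsilon>}"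

definition packing_growth ::
    "'x set \<Rightarrow> ('x \<Rightarrow> real) \<Rightarrow> 'x \<Rightarrow> ('x \<Rightarrow> 'x \<Rightarrow> real) \<Rightarrow> real \<Rightarrow> real \<Rightarrow> real \<Rightarrow> bool" where
  "packing_growth S f xstar l c0 \<epsilon>0 \<delta> \<longleftrightarrow>
     (\<exists>C>0. \<forall>\<epsilon>. 0 < \<epsilon> \<and> \<epsilon> \<le> \<epsilon>0 \<longrightarrow>
        packing_number S l (near_optimal S f xstar (c0 * \<epsilon>)) \<epsilon> \<le> ereal (C * \<epsilon> powr (- \<delta>)))"

definition near_opt_dim ::
    "'x set \<Rightarrow> ('x \<Rightarrow> real) \<Rightarrow> 'x \<Rightarrow> ('x \<Rightarrow> 'x \<Rightarrow> real) \<Rightarrow> real \<Rightarrow> real \<Rightarrow> ereal" where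
  "near_opt_dim S f xstar l c0 \<epsilon>0 =
     Inf {ereal \<delta> | \<delta>. 0 \<le> \<delta> \<and> packing_growth S f xstar l c0 \<epsilon>0 \<delta>}"

text \<open>A finite dimension is understood to be attained: the infimum is a minimum.\<close>

definition has_near_opt_dim ::
    "'x set \<Rightarrow> ('x \<Rightarrow> real) \<Rightarrow> 'x \<Rightarrow> ('x \<Rightarrow> 'x \<Rightarrow> real) \<Rightarrow> real \<Rightarrow> real \<Rightarrow> real \<Rightarrow> bool" where
  "has_near_opt_dim S f xstar l c0 \<epsilon>0 d \<longleftrightarrow>
     near_opt_dim S f xstar l c0 \<epsilon>0 = ereal d \<and> packing_growth S f xstar l c0 \<epsilon>0 d"


section \<open>Bandit problem with a hierarchical partition\<close>

text \<open>
  The action space is \<open>space A\<close>; its \<open>\<sigma>\<close>-algebra only serves to make the actions random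
  variables and the reward law \<open>K x\<close> of action \<open>x\<close> a probability kernel. Since \<open>f x\<close> is the mean
  of \<open>K x\<close>, measurability of \<open>f\<close> follows.
  The cell with index \<open>(h, i)\<close> is \<open>cell h i\<close>; only indices \<open>i < 2 ^ h\<close> matter.
\<close>

locale hierarchical_bandit =
  fixes A :: "'x measure"
    and K :: "'x \<Rightarrow> real measure"
    and f :: "'x \<Rightarrow> real"
    and xstar :: 'x
    and cell :: "nat \<Rightarrow> nat \<Rightarrow> 'x set"
    and l :: "'x \<Rightarrow> 'x \<Rightarrow> real"
    and \<nu>1 \<nu>2 \<rho> :: real
  assumes reward_kernel: "K \<in> A \<rightarrow>\<^sub>M prob_algebra borel"
    and reward_bounded: "x \<in> space A \<Longrightarrow> AE y in K x. y \<in> {0..1}"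
    and reward_mean: "x \<in> space A \<Longrightarrow> (LINT y|K x. y) = f x"
    and xstar_in: "xstar \<in> space A"
    and xstar_max: "x \<in> space A \<Longrightarrow> f x \<le> f xstar"
    and cell_root: "cell 0 0 = space A"
    and cell_split: "i < 2 ^ h \<Longrightarrow> cell h i = cell (h + 1) (2 * i) \<union> cell (h + 1) (2 * i + 1)"
    and cell_disjoint: "i < 2 ^ h \<Longrightarrow> cell (h + 1) (2 * i) \<inter> cell (h + 1) (2 * i + 1) = {}"
    and A1: "semimetric_on (space A) l"
    and constants: "0 < \<nu>1" "0 < \<nu>2" "0 < \<rho>" "\<rho> < 1"
    and A2: "\<exists>x. \<forall>h. \<forall>i<2 ^ h.
        x h i \<in> cell h i \<and>
        semi_diam l (cell h i) \<le> ereal (\<nu>1 * \<rho> ^ h) \<and>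
        semi_ball (space A) l (x h i) (\<nu>2 * \<rho> ^ h) \<subseteq> cell h i \<and>
        (\<forall>j<2 ^ h. i \<noteq> j \<longrightarrow>
           semi_ball (space A) l (x h i) (\<nu>2 * \<rho> ^ h) \<inter>
           semi_ball (space A) l (x h j) (\<nu>2 * \<rho> ^ h) = {})"
    and A3: "\<lbrakk>x \<in> space A; x' \<in> space A\<rbrakk> \<Longrightarrow>
        f xstar - f x' \<le> f xstar - f x + max (f xstar - f x) (l x x')"


section \<open>LD-HOO\<close>

type_synonym node = "nat \<times> nat"

definition children :: "node \<Rightarrow> node set" where
  "children p = {(fst p + 1, 2 * snd p), (fst p + 1, 2 * snd p + 1)}"

definition descends :: "node \<Rightarrow> node \<Rightarrow> bool" where
  "descends p q \<longleftrightarrow> (\<lambda>p q. q \<in> children p)\<^sup>*\<^sup>* p q"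

text \<open>In the following, \<open>s t\<close> is the node selected and \<open>y t\<close> the reward received in round
  \<open>t\<close>, along one realisation; rounds are numbered from 1 and the values at 0 are irrelevant.\<close>

definition visits :: "(nat \<Rightarrow> node) \<Rightarrow> nat \<Rightarrow> node \<Rightarrow> nat set" where
  "visits s t p = {\<tau>\<in>{1..t}. descends p (s \<tau>)}"

definition visit_count :: "(nat \<Rightarrow> node) \<Rightarrow> nat \<Rightarrow> node \<Rightarrow> nat" where
  "visit_count s t p = card (visits s t p)"

definition mean_reward :: "(nat \<Rightarrow> node) \<Rightarrow> (nat \<Rightarrow> real) \<Rightarrow> nat \<Rightarrow> node \<Rightarrow> real" where
  "mean_reward s y t p = (\<Sum>\<tau>\<in>visits s t p. y \<tau>) / real (visit_count s t p)"

definition u_value ::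
    "real \<Rightarrow> real \<Rightarrow> (nat \<Rightarrow> node) \<Rightarrow> (nat \<Rightarrow> real) \<Rightarrow> nat \<Rightarrow> node \<Rightarrow> ereal" where
  "u_value \<nu>1 \<rho> s y t p =
     (if visit_count s (t - 1) p = 0 then \<infinity>
      else ereal (mean_reward s y (t - 1) p
                  + sqrt (2 * ln (real t) / real (visit_count s (t - 1) p))
                  + \<nu>1 * \<rho> ^ fst p))"

function b_value ::
    "real \<Rightarrow> real \<Rightarrow> nat \<Rightarrow> (nat \<Rightarrow> node) \<Rightarrow> (nat \<Rightarrow> real) \<Rightarrow> nat \<Rightarrow> node \<Rightarrow> ereal" where
  "b_value \<nu>1 \<rho> H s y t (h, i) =
     (if visit_count s (t - 1) (h, i) = 0 then \<infinity>
      else if h < H then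
        min (u_value \<nu>1 \<rho> s y t (h, i))
            (max (b_value \<nu>1 \<rho> H s y t (h + 1, 2 * i))
                 (b_value \<nu>1 \<rho> H s y t (h + 1, 2 * i + 1)))
      else u_value \<nu>1 \<rho> s y t (h, i))"
  by pat_completeness auto
termination
  by (relation "Wellfounded.measure (\<lambda>(\<nu>1, \<rho>, H, s, y, t, h, i). H - h)") auto

declare b_value.simps [simp del]

fun tree :: "nat \<Rightarrow> (nat \<Rightarrow> node) \<Rightarrow> nat \<Rightarrow> node set" where
  "tree H s 0 = {(0, 0)}"
| "tree H s (Suc 0) = {(0, 0)}"
| "tree H s (Suc (Suc t)) =
     tree H s (Suc t) \<union> (if fst (s (Suc t)) < H then children (s (Suc t)) else {})"

definition is_leaf :: "node set \<Rightarrow> node \<Rightarrow> bool" where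
  "is_leaf T p \<longleftrightarrow> p \<in> T \<and> children p \<inter> T = {}"

text \<open>The nodes that can be met on the way down from the root, for some way of breaking ties.\<close>

inductive greedy_reach :: "node set \<Rightarrow> (node \<Rightarrow> ereal) \<Rightarrow> node \<Rightarrow> bool" for T b where
  root: "greedy_reach T b (0, 0)"
| step: "\<lbrakk>greedy_reach T b p; \<not> is_leaf T p; q \<in> children p; \<forall>q'\<in>children p. b q' \<le> b q\<rbrakk>
    \<Longrightarrow> greedy_reach T b q"

definition ld_hoo_select ::
    "real \<Rightarrow> real \<Rightarrow> nat \<Rightarrow> (nat \<Rightarrow> node) \<Rightarrow> (nat \<Rightarrow> real) \<Rightarrow> nat \<Rightarrow> node \<Rightarrow> bool" where
  "ld_hoo_select \<nu>1 \<rho> H s y t p \<longleftrightarrow>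
     greedy_reach (tree H s t) (b_value \<nu>1 \<rho> H s y t) p \<and> is_leaf (tree H s t) p"

text \<open>The information available just before the reward of round \<open>t\<close> is drawn: nodes and actions of
  rounds up to \<open>t\<close>, rewards of rounds before \<open>t\<close>.\<close>

definition past ::
    "'w measure \<Rightarrow> 'x measure \<Rightarrow> (nat \<Rightarrow> 'w \<Rightarrow> node) \<Rightarrow> (nat \<Rightarrow> 'w \<Rightarrow> 'x) \<Rightarrow> (nat \<Rightarrow> 'w \<Rightarrow> real)
      \<Rightarrow> nat \<Rightarrow> 'w measure" where
  "past M A N X Y t = sigma (space M)
     ({N \<tau> -` B \<inter> space M | \<tau> B. \<tau> \<in> {1..t}} \<union>
      {X \<tau> -` B \<inter> space M | \<tau> B. \<tau> \<in> {1..t} \<and> B \<in> sets A} \<union>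
      {Y \<tau> -` B \<inter> space M | \<tau> B. \<tau> \<in> {1..<t} \<and> B \<in> sets borel})"

text \<open>A run of LD-HOO with depth limit \<open>H\<close>. Tie-breaking and the choice of the action in the
  selected cell are arbitrary and may be random. The last assumption says that, given \<open>past\<close>
  (which includes the current action), the reward has law \<open>K (X t)\<close>.\<close>

locale ld_hoo = prob_space M
  for M :: "'w measure" +
  fixes A :: "'x measure"
    and K :: "'x \<Rightarrow> real measure"
    and cell :: "nat \<Rightarrow> nat \<Rightarrow> 'x set"
    and \<nu>1 \<rho> :: real
    and H :: nat
    and N :: "nat \<Rightarrow> 'w \<Rightarrow> node"
    and X :: "nat \<Rightarrow> 'w \<Rightarrow> 'x"
    and Y :: "nat \<Rightarrow> 'w \<Rightarrow> real"
  assumes depth_pos: "0 < H"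
    and N_measurable: "1 \<le> t \<Longrightarrow> N t \<in> M \<rightarrow>\<^sub>M count_space UNIV"
    and X_measurable: "1 \<le> t \<Longrightarrow> X t \<in> M \<rightarrow>\<^sub>M A"
    and Y_measurable: "1 \<le> t \<Longrightarrow> Y t \<in> borel_measurable M"
    and Y_bounded: "\<lbrakk>1 \<le> t; \<omega> \<in> space M\<rbrakk> \<Longrightarrow> Y t \<omega> \<in> {0..1}"
    and N_select: "\<lbrakk>1 \<le> t; \<omega> \<in> space M\<rbrakk> \<Longrightarrow>
        ld_hoo_select \<nu>1 \<rho> H (\<lambda>\<tau>. N \<tau> \<omega>) (\<lambda>\<tau>. Y \<tau> \<omega>) t (N t \<omega>)"
    and X_in_cell: "\<lbrakk>1 \<le> t; \<omega> \<in> space M\<rbrakk> \<Longrightarrow> X t \<omega> \<in> cell (fst (N t \<omega>)) (snd (N t \<omega>))"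
    and Y_law: "\<lbrakk>1 \<le> t; B \<in> sets borel\<rbrakk> \<Longrightarrow>
        AE \<omega> in M. real_cond_exp M (past M A N X Y t) (\<lambda>\<omega>. indicator B (Y t \<omega>)) \<omega>
                   = measure (K (X t \<omega>)) B"

definition regret ::
    "('x \<Rightarrow> real) \<Rightarrow> 'x \<Rightarrow> (nat \<Rightarrow> 'w \<Rightarrow> 'x) \<Rightarrow> nat \<Rightarrow> 'w \<Rightarrow> real" where
  "regret f xstar X n \<omega> = real n * f xstar - (\<Sum>t=1..n. f (X t \<omega>))"

end

theory Submission
  imports Defs
begin

text \<open>
  Call a node at depth \<open>h\<close> near-optimal if its cell contains a point that is
  \<open>2 * \<nu>1 * \<rho> ^ h\<close>-optimal; by (A3) all points of the cell are then
  \<open>4 * \<nu>1 * \<rho> ^ h\<close>-optimal, and a packing argument bounds the number of such nodes by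
  \<open>C * (\<nu>2 * \<rho> ^ h) powr (- d)\<close>. Rounds are charged to one of three kinds of nodes:
  near-optimal nodes at the depth limit, which cost \<open>4 * \<nu>1 * \<rho> ^ H\<close> per round;
  near-optimal nodes above it, which are selected at most once; and descendants of a first
  ancestor that is not near-optimal. A node of the last kind at depth \<open>h\<close> is visited
  \<open>O(ln n / (\<nu>1 * \<rho> ^ h)\<^sup>2)\<close> times in expectation: once it has been visited that often, a further
  visit requires a large deviation of its own mean reward or of that of a node containing
  the optimum. The resulting sum over depths is geometric and dominated by depth \<open>H\<close>.
\<close>

subsection \<open>Nodes and their ancestors\<close>

text \<open>The ancestor of \<open>q\<close> at depth \<open>k\<close>: halving an index moves to
  the parent, so the division undoes the last \<open>fst q - k\<close> turns. For
  \<open>k > fst q\<close> the truncated subtraction keeps the index, and the value is no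
  ancestor.\<close>

definition anc :: "nat \<Rightarrow> node \<Rightarrow> node" where
  "anc k q = (k, snd q div 2 ^ (fst q - k))"

lemma fst_anc [simp]: "fst (anc k q) = k"
  by (simp add: anc_def)

lemma anc_self [simp]: "anc (fst q) q = q"
  by (simp add: anc_def)

lemma mem_children_iff: "q \<in> children p \<longleftrightarrow> fst q = Suc (fst p) \<and> snd q div 2 = snd p"
  by (cases q) (auto simp: children_def)

lemma children_disjoint: "q \<in> children p \<Longrightarrow> q \<in> children p' \<Longrightarrow> p = p'"
  by (auto simp: mem_children_iff prod_eq_iff)

lemma anc_Suc_child: "k < fst q \<Longrightarrow> anc (Suc k) q \<in> children (anc k q)"
proof -
  assume "k < fst q"
  then have "snd q div 2 ^ (fst q - k) = snd q div (2 ^ (fst q - Suc k) * 2)"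
    by (metis Suc_diff_Suc power_Suc2)
  then show ?thesis by (simp add: mem_children_iff anc_def div_mult2_eq)
qed

lemma anc_child: "q \<in> children p \<Longrightarrow> k \<le> fst p \<Longrightarrow> anc k q = anc k p"
  by (auto simp: mem_children_iff anc_def Suc_diff_le div_mult2_eq)

lemma anc_index:
  assumes "snd q < 2 ^ fst q" "k \<le> fst q"
  shows "snd (anc k q) < 2 ^ k"
  using assms by (simp add: anc_def less_mult_imp_div_less flip: power_add)

lemma descends_anc: "k \<le> fst q \<Longrightarrow> descends (anc k q) q"
proof (induction rule: inc_induct)
  case base
  show ?case by (simp add: descends_def)
next
  case (step k)
  then show ?case
    unfolding descends_def by (meson anc_Suc_child converse_rtranclp_into_rtranclp)
qed

text \<open>Replaces the transitive closure by arithmetic: a node has exactly one ancestor at each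
  depth up to its own.\<close>

lemma descends_iff: "descends p q \<longleftrightarrow> fst p \<le> fst q \<and> anc (fst p) q = p"
proof
  assume "descends p q"
  then show "fst p \<le> fst q \<and> anc (fst p) q = p"
    unfolding descends_def
  proof (induction rule: rtranclp_induct)
    case base
    show ?case by simp
  next
    case (step q r)
    then show ?case by (auto simp: anc_child) (auto simp: mem_children_iff)
  qed
next
  assume "fst p \<le> fst q \<and> anc (fst p) q = p"
  then show "descends p q" by (metis descends_anc)
qed

section \<open>The growing tree and the greedy descent\<close>

lemma tree_eq:
  assumes "1 \<le> t"
  shows "tree H s t = insert (0, 0) (\<Union>\<tau>\<in>{\<tau>\<in>{1..<t}. fst (s \<tau>) < H}. children (s \<tau>))"
  using assms
proof (induction t rule: dec_induct)
  case base
  show ?case by simp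
next
  case (step t)
  then obtain t' where t': "t = Suc t'" by (cases t) auto
  have "{\<tau>\<in>{1..<Suc t}. fst (s \<tau>) < H}
      = {\<tau>\<in>{1..<t}. fst (s \<tau>) < H} \<union> (if fst (s t) < H then {t} else {})"
    using step by (auto simp: less_Suc_eq)
  then show ?case using step.IH t' by auto
qed

text \<open>The descent passes through every proper ancestor of \<open>q\<close>: it stopped at none
  of them and moved on to a child of largest value.\<close>

lemma greedy_reach_anc:
  assumes "greedy_reach T b q" "k < fst q"
  shows "\<not> is_leaf T (anc k q)" "q' \<in> children (anc k q) \<Longrightarrow> b q' \<le> b (anc (Suc k) q)"
proof -
  have "\<not> is_leaf T (anc k q) \<and> (\<forall>q'\<in>children (anc k q). b q' \<le> b (anc (Suc k) q))"
    using assms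
  proof (induction)
    case root
    then show ?case by simp
  next
    case (step p q)
    show ?case
    proof (cases "k < fst p")
      case True
      then show ?thesis using step by (simp add: anc_child[of q p])
    next
      case False
      then have "k = fst p" "Suc k = fst q" using step by (auto simp: mem_children_iff)
      then show ?thesis using step anc_child[of q p k] anc_self[of q] anc_self[of p] by auto
    qed
  qed
  then show "\<not> is_leaf T (anc k q)" "q' \<in> children (anc k q) \<Longrightarrow> b q' \<le> b (anc (Suc k) q)"
    by auto
qed

lemma greedy_reach_index: "greedy_reach T b q \<Longrightarrow> snd q < 2 ^ fst q"
  by (induction rule: greedy_reach.induct) (auto simp: mem_children_iff)

text \<open>Nodes enter the tree only as children of a selected node, and a child determines its
  parent. So a node with a child in the tree has itself been selected, and both of its children
  entered together.\<close>

lemma tree_inner_node: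
  assumes "1 \<le> t" "\<not> is_leaf (tree H s t) p" "p \<in> tree H s t"
  obtains \<tau> where "\<tau> \<in> {1..<t}" "s \<tau> = p" "fst p < H" "children p \<subseteq> tree H s t"
proof -
  from assms obtain q where q: "q \<in> children p" "q \<in> tree H s t"
    by (auto simp: is_leaf_def)
  then obtain \<tau> where \<tau>: "\<tau> \<in> {1..<t}" "fst (s \<tau>) < H" "q \<in> children (s \<tau>)"
    using assms(1) by (auto simp: tree_eq mem_children_iff)
  then have "p = s \<tau>" using q children_disjoint by blast
  then show ?thesis using \<tau> assms(1) by (intro that[of \<tau>]) (auto simp: tree_eq)
qed

lemma greedy_reach_tree:
  assumes "greedy_reach (tree H s t) b q" "1 \<le> t"
  shows "q \<in> tree H s t"
  using assms
proof induction
  case root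
  then show ?case by (simp add: tree_eq)
next
  case (step p q)
  then show ?case by (meson subsetD tree_inner_node)
qed

lemma greedy_reach_prefix:
  assumes "greedy_reach T b q" "k \<le> fst q"
  shows "greedy_reach T b (anc k q)"
  using assms
proof induction
  case root
  then show ?case by (simp add: anc_def greedy_reach.root)
next
  case (step p q)
  show ?case
  proof (cases "k \<le> fst p")
    case True
    then show ?thesis using step by (simp add: anc_child[of q p])
  next
    case False
    then have "k = fst q" using step by (auto simp: mem_children_iff)
    then show ?thesis using greedy_reach.step[OF step.hyps(1-4)] by simp
  qed
qed

subsection \<open>The selection rule along one realisation\<close>

lemma b_value_le_u: "b_value \<nu>1 \<rho> H s y t p \<le> u_value \<nu>1 \<rho> s y t p"
proof -
  obtain h i where p: "p = (h, i)" by fastforce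
  show ?thesis unfolding p by (subst b_value.simps) (simp add: u_value_def)
qed

lemma b_value_le_child:
  assumes "visit_count s (t - 1) p \<noteq> 0" "fst p < H"
    and "\<And>q. q \<in> children p \<Longrightarrow> b_value \<nu>1 \<rho> H s y t q \<le> B"
  shows "b_value \<nu>1 \<rho> H s y t p \<le> B"
proof -
  obtain h i where p: "p = (h, i)" by fastforce
  show ?thesis
    using assms unfolding p by (subst b_value.simps) (simp add: children_def min_le_iff_disj)
qed

lemma visit_count_pos: "\<tau> \<in> {1..t} \<Longrightarrow> descends p (s \<tau>) \<Longrightarrow> visit_count s t p \<noteq> 0"
  by (auto simp: visit_count_def visits_def)

locale ld_hoo_path =
  fixes \<nu>1 \<rho> :: real and H :: nat and s :: "nat \<Rightarrow> node" and y :: "nat \<Rightarrow> real"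
  assumes select: "1 \<le> t \<Longrightarrow> ld_hoo_select \<nu>1 \<rho> H s y t (s t)"
begin

lemma greedy: "1 \<le> t \<Longrightarrow> greedy_reach (tree H s t) (b_value \<nu>1 \<rho> H s y t) (s t)"
  using select by (simp add: ld_hoo_select_def)

lemma selected_index: "1 \<le> t \<Longrightarrow> snd (s t) < 2 ^ fst (s t)"
  using greedy greedy_reach_index by blast

text \<open>A selected node other than the root was created by selecting its parent in an earlier
  round, so the depth grows by at most one per round.\<close>

lemma selected_depth_less: "1 \<le> t \<Longrightarrow> fst (s t) < t"
proof (induction t rule: less_induct)
  case (less t)
  have "s t \<in> tree H s t" using greedy_reach_tree greedy less.prems by blast
  then consider "s t = (0, 0)" | \<tau> where "\<tau> \<in> {1..<t}" "s t \<in> children (s \<tau>)"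
    using less.prems by (auto simp: tree_eq)
  then show ?case
  proof cases
    case 1
    then show ?thesis using less.prems by simp
  next
    case 2
    then show ?thesis using less.IH[of \<tau>] by (auto simp: mem_children_iff)
  qed
qed

lemma selected_depth_le: "1 \<le> t \<Longrightarrow> fst (s t) \<le> H"
proof -
  assume t: "1 \<le> t"
  have "s t \<in> tree H s t" using greedy_reach_tree greedy t by blast
  then show ?thesis
    using t by (auto simp: tree_eq mem_children_iff)
qed

text \<open>A node selected above the depth limit receives children and is never a leaf
  again.\<close>

lemma selected_once:
  assumes "1 \<le> \<tau>" "\<tau> < t" "s t = s \<tau>"
  shows "fst (s t) = H"
proof (rule ccontr)
  assume "fst (s t) \<noteq> H"
  then have "fst (s \<tau>) < H" using assms selected_depth_le[of t] by simp
  then have "children (s t) \<subseteq> tree H s t" using assms by (auto simp: tree_eq)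
  moreover have "is_leaf (tree H s t) (s t)"
    using select[of t] assms by (simp add: ld_hoo_select_def)
  ultimately show False by (auto simp: is_leaf_def children_def)
qed

text \<open>Proper ancestors of the selected node have been selected before. Hence their
  \<open>b\<close>-values come from the recursion and not from the default \<infinity>.\<close>

lemma inner_ancestor:
  assumes "1 \<le> t" "k < fst (s t)"
  shows "visit_count s (t - 1) (anc k (s t)) \<noteq> 0" "k < H"
proof -
  have "anc k (s t) \<in> tree H s t"
    using greedy_reach_tree[OF greedy_reach_prefix[OF greedy[OF assms(1)]] assms(1)] assms(2)
    by simp
  moreover have "\<not> is_leaf (tree H s t) (anc k (s t))"
    by (rule greedy_reach_anc(1)[OF greedy[OF assms(1)] assms(2)])
  ultimately obtain \<tau> where \<tau>: "\<tau> \<in> {1..<t}" "s \<tau> = anc k (s t)" "fst (anc k (s t)) < H"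
    using tree_inner_node[OF assms(1)] by blast
  then show "k < H" by simp
  show "visit_count s (t - 1) (anc k (s t)) \<noteq> 0"
    using \<tau> by (intro visit_count_pos[of \<tau>]) (auto simp: descends_def)
qed

text \<open>The \<open>b\<close>-value of a visited node above the depth limit is at most the larger
  one of its children, and the descent moves to a child attaining it.\<close>

lemma b_value_anc_mono:
  assumes "1 \<le> t" "j \<le> h" "h \<le> fst (s t)"
  shows "b_value \<nu>1 \<rho> H s y t (anc j (s t)) \<le> b_value \<nu>1 \<rho> H s y t (anc h (s t))"
  using assms(2)
proof (induction rule: inc_induct)
  case base
  show ?case by simp
next
  case (step k)
  then have k: "k < fst (s t)" using assms by simp
  have "b_value \<nu>1 \<rho> H s y t (anc k (s t)) \<le> b_value \<nu>1 \<rho> H s y t (anc (Suc k) (s t))"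
  proof (rule b_value_le_child)
    show "visit_count s (t - 1) (anc k (s t)) \<noteq> 0" "fst (anc k (s t)) < H"
      using inner_ancestor[OF assms(1) k] by auto
  qed (rule greedy_reach_anc(2)[OF greedy[OF assms(1)] k])
  then show ?case using step.IH by simp
qed

text \<open>Cuts the optimal path off at depth \<open>t\<close>, which keeps the later union bound
  over its nodes finite.\<close>

lemma visited_depth_less:
  assumes "visit_count s (t - 1) p \<noteq> 0"
  shows "fst p < t"
proof -
  obtain \<tau> where "\<tau> \<in> {1..t - 1}" "descends p (s \<tau>)"
    using assms by (auto simp: visit_count_def visits_def card_eq_0_iff)
  then show ?thesis using selected_depth_less[of \<tau>] by (auto simp: descends_iff)
qed

text \<open>Unless \<open>u\<close> is small at the node itself, the minimum in the recursion passes
  the bound on to both children, in particular to the next node of the path. From the depth limit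
  on, \<open>b\<close> equals \<open>u\<close>. A finite bound excludes unvisited nodes.\<close>

lemma b_value_witness:
  assumes path: "\<And>j. (Suc j, opt (Suc j)) \<in> children (j, opt j)"
    and "b_value \<nu>1 \<rho> H s y t (j, opt j) \<le> ereal m"
  shows "\<exists>i\<ge>j. visit_count s (t - 1) (i, opt i) \<noteq> 0 \<and> u_value \<nu>1 \<rho> s y t (i, opt i) \<le> ereal m"
  using assms(2)
proof (induction "H - j" arbitrary: j)
  case 0
  then have "visit_count s (t - 1) (j, opt j) \<noteq> 0 \<and> u_value \<nu>1 \<rho> s y t (j, opt j) \<le> ereal m"
    by (subst (asm) b_value.simps) (simp split: if_splits)
  then show ?case by blast
next
  case (Suc d)
  have vis: "visit_count s (t - 1) (j, opt j) \<noteq> 0"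
    using Suc.prems by (subst (asm) b_value.simps) (simp split: if_splits)
  show ?case
  proof (cases "u_value \<nu>1 \<rho> s y t (j, opt j) \<le> ereal m")
    case True
    then show ?thesis using vis by blast
  next
    case False
    have "j < H" using Suc.hyps by simp
    then have "b_value \<nu>1 \<rho> H s y t (j + 1, 2 * opt j) \<le> ereal m
      \<and> b_value \<nu>1 \<rho> H s y t (j + 1, 2 * opt j + 1) \<le> ereal m"
      using Suc.prems False vis
      by (subst (asm) b_value.simps) (simp add: min_le_iff_disj)
    then have "b_value \<nu>1 \<rho> H s y t (Suc j, opt (Suc j)) \<le> ereal m"
      using path[of j] by (auto simp: children_def)
    moreover have "d = H - Suc j" using Suc.hyps by simp
    ultimately obtain i where "Suc j \<le> i" "visit_count s (t - 1) (i, opt i) \<noteq> 0"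
        "u_value \<nu>1 \<rho> s y t (i, opt i) \<le> ereal m"
      using Suc.hyps(1)[of "Suc j"] by blast
    then show ?thesis using Suc_leD by blast
  qed
qed

text \<open>\<open>opt\<close> is the path of nodes containing the optimum. At the node where the selected path leaves
  it, the chosen child has a \<open>b\<close>-value at least that of the optimal child, and at most
  \<open>u_value p\<close> because \<open>b\<close>-values increase along the selected path.\<close>

lemma selection_cause:
  assumes "1 \<le> t"
    and path: "opt 0 = 0" "\<And>j. (Suc j, opt (Suc j)) \<in> children (j, opt j)"
    and p: "descends p (s t)" "snd p \<noteq> opt (fst p)"
  shows "ereal m < u_value \<nu>1 \<rho> s y t p \<or>
    (\<exists>j\<in>{1..<t}. visit_count s (t - 1) (j, opt j) \<noteq> 0 \<and>
       u_value \<nu>1 \<rho> s y t (j, opt j) \<le> ereal m)"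
proof -
  define b where "b = b_value \<nu>1 \<rho> H s y t"
  define q where "q = s t"
  have h: "fst p \<le> fst q" "anc (fst p) q = p" using p by (auto simp: descends_iff q_def)
  have "snd q < 2 ^ fst q" using selected_index assms(1) by (simp add: q_def)
  then have "anc 0 q = (0, opt 0)" by (simp add: anc_def path)
  moreover have ne: "anc (fst p) q \<noteq> (fst p, opt (fst p))" using p h by (metis snd_conv)
  ultimately obtain k where k: "k < fst p" "anc k q = (k, opt k)"
    "anc (Suc k) q \<noteq> (Suc k, opt (Suc k))"
  proof -
    \<comment> \<open>The least depth at which the selected path is off the optimal one. It is not 0
      because both paths start at the root, so its predecessor is the last common node.\<close>
    define k where "k = (LEAST k. anc k q \<noteq> (k, opt k))"
    have 1: "anc k q \<noteq> (k, opt k)" unfolding k_def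
      by (rule LeastI[of "\<lambda>k. anc k q \<noteq> (k, opt k)"]) (rule ne)
    have 2: "k \<le> fst p" unfolding k_def by (rule Least_le) (rule ne)
    have "k \<noteq> 0" using 1 \<open>anc 0 q = (0, opt 0)\<close> by metis
    then obtain k' where k': "k = Suc k'" using not0_implies_Suc by blast
    then have "k' < (LEAST k. anc k q \<noteq> (k, opt k))" by (simp add: k_def)
    then have "anc k' q = (k', opt k')" using not_less_Least by blast
    then show ?thesis using that[of k'] 1 2 k' by auto
  qed
  have "b (Suc k, opt (Suc k)) \<le> b (anc (Suc k) q)"
    unfolding b_def
    by (rule greedy_reach_anc(2)[OF greedy[OF assms(1), folded q_def]])
      (use k h path in auto)
  also have "\<dots> \<le> b p"
    using b_value_anc_mono[OF assms(1), of "Suc k" "fst p"] h k by (simp add: b_def q_def)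
  also have "\<dots> \<le> u_value \<nu>1 \<rho> s y t p" by (simp add: b_def b_value_le_u)
  finally have le: "b (Suc k, opt (Suc k)) \<le> u_value \<nu>1 \<rho> s y t p" .
  show ?thesis
  proof (cases "b (Suc k, opt (Suc k)) \<le> ereal m")
    case True
    then obtain i where i: "i \<ge> Suc k" "visit_count s (t - 1) (i, opt i) \<noteq> 0"
      "u_value \<nu>1 \<rho> s y t (i, opt i) \<le> ereal m"
      using b_value_witness[OF path(2) True[unfolded b_def]] by blast
    \<comment> \<open>\<open>Suc k \<le> i\<close> and the depth bound for visited nodes place
      \<open>i\<close> in \<open>{1..<t}\<close>.\<close>
    then show ?thesis using visited_depth_less[of t "(i, opt i)"]
      by (intro disjI2 bexI[of _ i]) auto
  next
    case False
    then show ?thesis using le by (meson less_le_trans not_le)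
  qed
qed

end

lemma measurable_sigmaI:
  assumes "g \<in> space M \<rightarrow> space B" "\<And>S. S \<in> sets B \<Longrightarrow> g -` S \<inter> space M \<in> G" "G \<subseteq> Pow (space M)"
  shows "g \<in> sigma (space M) G \<rightarrow>\<^sub>M B"
  using assms by (intro measurableI) auto

subsection \<open>Deviations of the rewards\<close>

context hierarchical_bandit
begin

lemma f_measurable [measurable]: "f \<in> borel_measurable A"
proof -
  have "(\<lambda>x. LINT y|K x. y) \<in> borel_measurable A"
    using measurable_prob_algebraD[OF reward_kernel]
    by (rule measurable_compose) (rule integral_measurable_subprob_algebra, simp)
  then show ?thesis by (subst measurable_cong[where g = "\<lambda>x. LINT y|K x. y"])
      (auto simp: reward_mean)
qed

lemma reward_law:
  assumes "x \<in> space A"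
  shows "prob_space (K x)" "sets (K x) = sets borel"
    "interval_bounded_random_variable (K x) (\<lambda>y. y) 0 1"
proof -
  have K: "K x \<in> space (prob_algebra borel)"
    using measurable_space[OF reward_kernel assms] .
  then show 1: "prob_space (K x)" and 2: "sets (K x) = sets borel"
    by (auto simp: space_prob_algebra)
  show "interval_bounded_random_variable (K x) (\<lambda>y. y) 0 1"
    using 1 2 reward_bounded[OF assms]
    by (auto simp: interval_bounded_random_variable_def interval_bounded_random_variable_axioms_def
        intro: measurable_ident_sets)
qed

lemma f_bounds:
  assumes "x \<in> space A"
  shows "0 \<le> f x" "f x \<le> 1"
proof -
  interpret interval_bounded_random_variable "K x" "\<lambda>y. y" 0 1 using reward_law[OF assms] by simp
  have "0 \<le> (LINT y|K x. y)"
    using AE_in_interval by (intro integral_nonneg_AE) auto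
  moreover have "(LINT y|K x. y) \<le> (LINT y|K x. 1)"
    using AE_in_interval by (intro integral_mono_AE) auto
  ultimately show "0 \<le> f x" "f x \<le> 1" using reward_mean[OF assms] by (auto simp: prob_space)
qed

text \<open>Hoeffding's lemma on an interval of length 1, applied with a positive exponent. A
  negative \<open>a\<close> is handled by reflecting the reward to \<open>- y\<close> in
  \<open>[-1, 0]\<close>.\<close>

lemma reward_mgf_le:
  assumes x: "x \<in> space A"
  shows "(\<integral>\<^sup>+y. ennreal (exp (a * (y - f x))) \<partial>K x) \<le> ennreal (exp (a\<^sup>2 / 8))"
proof (cases a "0 :: real" rule: linorder_cases)
  case less
  interpret I: interval_bounded_random_variable "K x" "\<lambda>y. y" 0 1 using reward_law[OF x] by simp
  interpret J: interval_bounded_random_variable "K x" "\<lambda>y. - y" "-1" 0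
    by unfold_locales (use I.AE_in_interval in auto)
  show ?thesis
    using J.Hoeffdings_lemma_nn_integral[of "- a"] less reward_mean[OF x]
    by (simp add: algebra_simps)
next
  case equal
  interpret prob_space "K x" using reward_law[OF x] by simp
  show ?thesis using equal by (simp add: emeasure_space_1)
next
  case greater
  interpret I: interval_bounded_random_variable "K x" "\<lambda>y. y" 0 1 using reward_law[OF x] by simp
  show ?thesis
    using I.Hoeffdings_lemma_nn_integral[of a] greater reward_mean[OF x] by simp
qed

end

section \<open>The history of a run and the conditional law of the rewards\<close>

locale ld_hoo_run =
  hierarchical_bandit A K f xstar cell l \<nu>1 \<nu>2 \<rho> + ld_hoo M A K cell \<nu>1 \<rho> H N X Y
  for A :: "'x measure" and K f xstar cell l \<nu>1 \<nu>2 \<rho>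
    and M :: "'w measure" and H N X Y
begin

lemma X_space: "1 \<le> t \<Longrightarrow> \<omega> \<in> space M \<Longrightarrow> X t \<omega> \<in> space A"
  using measurable_space[OF X_measurable] .

abbreviation "hist t \<equiv> past M A N X Y t"

lemma
  shows N_hist: "\<tau> \<in> {1..t} \<Longrightarrow> N \<tau> \<in> hist t \<rightarrow>\<^sub>M count_space UNIV"
    and X_hist: "\<tau> \<in> {1..t} \<Longrightarrow> X \<tau> \<in> hist t \<rightarrow>\<^sub>M A"
    and Y_hist: "\<tau> \<in> {1..<t} \<Longrightarrow> Y \<tau> \<in> borel_measurable (hist t)"
    and subalgebra_hist: "subalgebra M (hist t)"
proof -
  define G where "G = {N \<tau> -` B \<inter> space M | \<tau> B. \<tau> \<in> {1..t}} \<union>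
      {X \<tau> -` B \<inter> space M | \<tau> B. \<tau> \<in> {1..t} \<and> B \<in> sets A} \<union>
      {Y \<tau> -` B \<inter> space M | \<tau> B. \<tau> \<in> {1..<t} \<and> B \<in> sets borel}"
  have hist: "hist t = sigma (space M) G" by (simp add: past_def G_def)
  have sub: "G \<subseteq> Pow (space M)" by (auto simp: G_def)
  show "\<tau> \<in> {1..t} \<Longrightarrow> N \<tau> \<in> hist t \<rightarrow>\<^sub>M count_space UNIV"
    unfolding hist using sub by (intro measurable_sigmaI) (auto simp only: G_def space_count_space)
  show "\<tau> \<in> {1..t} \<Longrightarrow> X \<tau> \<in> hist t \<rightarrow>\<^sub>M A"
    unfolding hist using sub X_space by (intro measurable_sigmaI) (auto simp: G_def)
  show "\<tau> \<in> {1..<t} \<Longrightarrow> Y \<tau> \<in> borel_measurable (hist t)"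
    unfolding hist using sub by (intro measurable_sigmaI) (auto simp: G_def)
  have "G \<subseteq> sets M"
    using N_measurable X_measurable Y_measurable by (auto simp: G_def intro: measurable_sets)
  then show "subalgebra M (hist t)"
    by (simp add: subalgebra_def hist sub sets.sigma_sets_subset)
qed

text \<open>Extends \<open>Y_law\<close> from indicators to nonnegative measurable functions of the
  reward, with a weight known from the history. With \<open>G\<close> as density, the law of
  \<open>Y t\<close> agrees on Borel sets with the mixture of the laws
  \<open>K (X t \<omega>)\<close>; then \<open>\<phi>\<close> is integrated against both. The bound
  on \<open>G\<close> makes the real integrals finite.\<close>

lemma reward_conditional_law:
  assumes t: "1 \<le> t" and G: "G \<in> borel_measurable (hist t)" "\<And>\<omega>. \<omega> \<in> space M \<Longrightarrow> 0 \<le> G \<omega> \<and> G \<omega> \<le> C"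
    and \<phi>: "\<phi> \<in> borel_measurable borel"
  shows "(\<integral>\<^sup>+\<omega>. ennreal (G \<omega>) * \<phi> (Y t \<omega>) \<partial>M)
       = (\<integral>\<^sup>+\<omega>. ennreal (G \<omega>) * (\<integral>\<^sup>+y. \<phi> y \<partial>K (X t \<omega>)) \<partial>M)"
proof -
  interpret F: finite_measure_subalgebra M "hist t"
    by unfold_locales (rule subalgebra_hist)
  have C: "0 \<le> C" using G(2) not_empty by (meson equals0I order_trans)
  have GM [measurable]: "G \<in> borel_measurable M"
    by (rule measurable_from_subalg[OF subalgebra_hist G(1)])
  have [measurable]: "Y t \<in> borel_measurable M" "X t \<in> M \<rightarrow>\<^sub>M A"
    using t Y_measurable X_measurable by auto
  have KA [measurable]: "K \<in> A \<rightarrow>\<^sub>M subprob_algebra borel"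
    using measurable_prob_algebraD[OF reward_kernel] .
  have Kt: "(\<lambda>\<omega>. K (X t \<omega>)) \<in> density M (\<lambda>\<omega>. ennreal (G \<omega>)) \<rightarrow>\<^sub>M subprob_algebra borel"
    by simp
  have ne: "space (density M (\<lambda>\<omega>. ennreal (G \<omega>))) \<noteq> {}" by (simp add: not_empty)
  let ?D = "density M (\<lambda>\<omega>. ennreal (G \<omega>))"
  have "distr ?D borel (Y t) = ?D \<bind> (\<lambda>\<omega>. K (X t \<omega>))"
  proof (rule measure_eqI)
    show "sets (distr ?D borel (Y t)) = sets (?D \<bind> (\<lambda>\<omega>. K (X t \<omega>)))"
      by (simp add: sets_bind_measurable[OF Kt ne])
    fix B assume "B \<in> sets (distr ?D borel (Y t))"
    then have B [measurable]: "B \<in> sets borel" by simp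
    have mK: "(\<lambda>\<omega>. measure (K (X t \<omega>)) B) \<in> borel_measurable M"
      by (rule measurable_compose[OF \<open>X t \<in> M \<rightarrow>\<^sub>M A\<close>])
        (rule measure_measurable_subprob_algebra2[OF _ KA], simp)
    have int: "integrable M (\<lambda>\<omega>. G \<omega> * indicator B (Y t \<omega>))"
      using G(2) C by (intro integrable_const_bound[where B = C]) (auto simp: indicator_def)
    have Kle: "measure (K (X t \<omega>)) B \<le> 1" if "\<omega> \<in> space M" for \<omega>
      using reward_law(1)[OF X_space[OF t that]] prob_space.prob_le_1 by blast
    have int': "integrable M (\<lambda>\<omega>. G \<omega> * measure (K (X t \<omega>)) B)"
      using G(2) Kle mK
      by (intro integrable_const_bound[where B = C])
        (auto simp: abs_mult intro!: order_trans[OF mult_right_le_one_le])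
    have "emeasure (distr ?D borel (Y t)) B = (\<integral>\<^sup>+\<omega>. ennreal (G \<omega> * indicator B (Y t \<omega>)) \<partial>M)"
      using measurable_sets[OF \<open>Y t \<in> borel_measurable M\<close> B]
      by (subst emeasure_distr)
        (auto simp: emeasure_density indicator_def intro!: nn_integral_cong)
    also have "\<dots> = ennreal (\<integral>\<omega>. G \<omega> * indicator B (Y t \<omega>) \<partial>M)"
      using int G(2) by (intro nn_integral_eq_integral) auto
    \<comment> \<open>\<open>G\<close> is measurable for the history, so the indicator may be
      replaced by its conditional expectation, which \<open>Y_law\<close> identifies.\<close>
    also have "(\<integral>\<omega>. G \<omega> * indicator B (Y t \<omega>) \<partial>M)
        = (\<integral>\<omega>. G \<omega> * real_cond_exp M (hist t) (\<lambda>\<omega>. indicator B (Y t \<omega>)) \<omega> \<partial>M)"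
      using int G(1) by (intro F.real_cond_exp_intg(2)[symmetric]) auto
    also have "\<dots> = (\<integral>\<omega>. G \<omega> * measure (K (X t \<omega>)) B \<partial>M)"
      using Y_law[OF t B] mK by (intro integral_cong_AE) auto
    also have "ennreal \<dots> = (\<integral>\<^sup>+\<omega>. ennreal (G \<omega> * measure (K (X t \<omega>)) B) \<partial>M)"
      using int' G(2) by (intro nn_integral_eq_integral[symmetric]) auto
    also have "\<dots> = (\<integral>\<^sup>+\<omega>. ennreal (G \<omega>) * emeasure (K (X t \<omega>)) B \<partial>M)"
    proof (intro nn_integral_cong)
      fix \<omega> assume \<omega>: "\<omega> \<in> space M"
      interpret K: prob_space "K (X t \<omega>)" using reward_law(1)[OF X_space[OF t \<omega>]] .
      show "ennreal (G \<omega> * measure (K (X t \<omega>)) B) = ennreal (G \<omega>) * emeasure (K (X t \<omega>)) B"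
        using G(2)[OF \<omega>] by (simp add: K.emeasure_eq_measure ennreal_mult)
    qed
    also have "\<dots> = emeasure (?D \<bind> (\<lambda>\<omega>. K (X t \<omega>))) B"
      using measurable_emeasure_kernel[OF KA B]
      by (subst emeasure_bind[OF ne Kt B], subst nn_integral_density) auto
    finally show "emeasure (distr ?D borel (Y t)) B = emeasure (?D \<bind> (\<lambda>\<omega>. K (X t \<omega>))) B" .
  qed
  then have "(\<integral>\<^sup>+y. \<phi> y \<partial>distr ?D borel (Y t)) = (\<integral>\<^sup>+y. \<phi> y \<partial>(?D \<bind> (\<lambda>\<omega>. K (X t \<omega>))))"
    by simp
  moreover have "(\<integral>\<^sup>+y. \<phi> y \<partial>distr ?D borel (Y t)) = (\<integral>\<^sup>+\<omega>. ennreal (G \<omega>) * \<phi> (Y t \<omega>) \<partial>M)"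
    using \<phi> by (subst nn_integral_distr, simp, simp) (subst nn_integral_density, auto)
  moreover have "(\<integral>\<^sup>+y. \<phi> y \<partial>(?D \<bind> (\<lambda>\<omega>. K (X t \<omega>))))
      = (\<integral>\<^sup>+\<omega>. ennreal (G \<omega>) * (\<integral>\<^sup>+y. \<phi> y \<partial>K (X t \<omega>)) \<partial>M)"
    using \<phi> by (subst nn_integral_bind[OF \<phi> Kt], subst nn_integral_density) auto
  ultimately show ?thesis by simp
qed

definition hits :: "node \<Rightarrow> nat \<Rightarrow> 'w \<Rightarrow> real" where
  "hits p t \<omega> = (\<Sum>\<tau>=1..t. of_bool (descends p (N \<tau> \<omega>)))"

text \<open>The noise accumulated at a node. Rewards are centred at the payoff of the action played,
  not at an average over the cell, so that increments have conditional mean zero given the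
  history.\<close>

definition dev :: "node \<Rightarrow> nat \<Rightarrow> 'w \<Rightarrow> real" where
  "dev p t \<omega> = (\<Sum>\<tau>=1..t. of_bool (descends p (N \<tau> \<omega>)) * (Y \<tau> \<omega> - f (X \<tau> \<omega>)))"

lemma hits_eq_visit_count: "hits p t \<omega> = real (visit_count (\<lambda>\<tau>. N \<tau> \<omega>) t p)"
  by (simp add: hits_def visit_count_def visits_def of_bool_def sum.If_cases Int_def)

lemma dev_eq_sum_visits:
  "dev p t \<omega> = (\<Sum>\<tau>\<in>visits (\<lambda>\<tau>. N \<tau> \<omega>) t p. Y \<tau> \<omega> - f (X \<tau> \<omega>))"
  unfolding dev_def visits_def sum.inter_filter[OF finite_atLeastAtMost] by (rule sum.cong) auto

lemma descends_measurable_hist: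
  "\<tau> \<in> {1..t} \<Longrightarrow> (\<lambda>\<omega>. of_bool (descends p (N \<tau> \<omega>)) :: real) \<in> borel_measurable (hist t)"
  by (rule measurable_compose[OF N_hist]) auto

lemma hits_measurable_hist: "u \<le> t \<Longrightarrow> hits p u \<in> borel_measurable (hist t)"
  unfolding hits_def by (intro borel_measurable_sum descends_measurable_hist) auto

text \<open>The inequality is strict, unlike for \<open>hits\<close>: the history of round
  \<open>t\<close> contains the node and the action of that round but not its reward.\<close>

lemma dev_measurable_hist: "u < t \<Longrightarrow> dev p u \<in> borel_measurable (hist t)"
  unfolding dev_def
  by (intro borel_measurable_sum borel_measurable_times descends_measurable_hist
      borel_measurable_diff Y_hist measurable_compose[OF X_hist f_measurable]) auto

lemma hits_measurable [measurable]: "hits p u \<in> borel_measurable M"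
  using measurable_from_subalg[OF subalgebra_hist hits_measurable_hist] by blast

lemma dev_measurable [measurable]: "dev p u \<in> borel_measurable M"
  using measurable_from_subalg[OF subalgebra_hist dev_measurable_hist] by blast

lemma hits_bounds: "0 \<le> hits p t \<omega>" "hits p t \<omega> \<le> real t"
proof -
  show "0 \<le> hits p t \<omega>" unfolding hits_def by (intro sum_nonneg) auto
  have "hits p t \<omega> \<le> (\<Sum>\<tau>=1..t. 1)" unfolding hits_def by (intro sum_mono) auto
  then show "hits p t \<omega> \<le> real t" by simp
qed

lemma abs_dev_le: "\<omega> \<in> space M \<Longrightarrow> \<bar>dev p t \<omega>\<bar> \<le> real t"
proof -
  assume \<omega>: "\<omega> \<in> space M"
  have "\<bar>dev p t \<omega>\<bar> \<le> (\<Sum>\<tau>=1..t. \<bar>of_bool (descends p (N \<tau> \<omega>)) * (Y \<tau> \<omega> - f (X \<tau> \<omega>))\<bar>)"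
    unfolding dev_def by (rule sum_abs)
  also have "\<dots> \<le> (\<Sum>\<tau>=1..t. 1)"
  proof (rule sum_mono)
    fix \<tau> assume "\<tau> \<in> {1..t}"
    then show "\<bar>of_bool (descends p (N \<tau> \<omega>)) * (Y \<tau> \<omega> - f (X \<tau> \<omega>))\<bar> \<le> 1"
      using Y_bounded[of \<tau> \<omega>] f_bounds[OF X_space[of \<tau> \<omega>]] \<omega> by (auto simp: abs_if)
  qed
  finally show ?thesis by simp
qed

text \<open>A round that visits \<open>p\<close> adds \<open>a\<close> times its noise minus
  \<open>a\<^sup>2 / 8\<close> to the exponent; by Hoeffding's lemma this factor has conditional
  mean at most 1. Other rounds change nothing.\<close>

lemma supermartingale:
  "(\<integral>\<^sup>+\<omega>. ennreal (exp (a * dev p t \<omega> - a\<^sup>2 / 8 * hits p t \<omega>)) \<partial>M) \<le> 1"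
proof (induction t)
  case 0
  show ?case by (simp add: dev_def hits_def emeasure_space_1)
next
  case (Suc t)
  define Z where "Z = (\<lambda>t \<omega>. exp (a * dev p t \<omega> - a\<^sup>2 / 8 * hits p t \<omega>))"
  define V :: "'w \<Rightarrow> real" where "V = (\<lambda>\<omega>. of_bool (descends p (N (Suc t) \<omega>)))"
  \<comment> \<open>\<open>G\<close> collects the factors known before the reward is drawn, leaving
    out only \<open>exp (a * Y (Suc t) \<omega>)\<close>; \<open>V\<close> restricts it to rounds
    that visit \<open>p\<close>.\<close>
  define G where "G = (\<lambda>\<omega>. V \<omega> * (Z t \<omega> * exp (- a * f (X (Suc t) \<omega>) - a\<^sup>2 / 8)))"
  have V [measurable]: "V \<in> borel_measurable (hist (Suc t))"
    unfolding V_def by (rule descends_measurable_hist) simp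
  have [measurable]: "Z t \<in> borel_measurable (hist (Suc t))"
    unfolding Z_def using dev_measurable_hist[of t "Suc t" p] hits_measurable_hist[of t "Suc t" p]
    by measurable
  have [measurable]: "X (Suc t) \<in> hist (Suc t) \<rightarrow>\<^sub>M A" by (rule X_hist) simp
  have G: "G \<in> borel_measurable (hist (Suc t))" unfolding G_def by measurable
  have [measurable]: "V \<in> borel_measurable M" "Z t \<in> borel_measurable M" "G \<in> borel_measurable M"
    "Y (Suc t) \<in> borel_measurable M"
    using measurable_from_subalg[OF subalgebra_hist V]
      measurable_from_subalg[OF subalgebra_hist \<open>Z t \<in> borel_measurable (hist (Suc t))\<close>]
      measurable_from_subalg[OF subalgebra_hist G] Y_measurable by auto
  have Gle: "0 \<le> G \<omega> \<and> G \<omega> \<le> exp (\<bar>a\<bar> * real t + \<bar>a\<bar>)" if "\<omega> \<in> space M" for \<omega>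
  proof -
    have "a * dev p t \<omega> \<le> \<bar>a\<bar> * real t"
      using abs_dev_le[OF that, of p t]
      by (metis abs_ge_self abs_ge_zero abs_mult mult_left_mono order_trans)
    moreover have "- a * f (X (Suc t) \<omega>) \<le> \<bar>a\<bar> * 1"
      using f_bounds[OF X_space[OF _ that], of "Suc t"]
      by (metis abs_ge_self abs_ge_zero abs_minus_cancel abs_mult abs_of_nonneg le_add1
          mult_left_mono order_trans plus_1_eq_Suc)
    moreover have "0 \<le> a\<^sup>2 / 8 * hits p t \<omega>" using hits_bounds by simp
    ultimately have "a * dev p t \<omega> - a\<^sup>2 / 8 * hits p t \<omega> + (- a * f (X (Suc t) \<omega>) - a\<^sup>2 / 8)
        \<le> \<bar>a\<bar> * real t + \<bar>a\<bar>"
      by (smt (verit) zero_le_power2 divide_nonneg_nonneg)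
    then have "Z t \<omega> * exp (- a * f (X (Suc t) \<omega>) - a\<^sup>2 / 8) \<le> exp (\<bar>a\<bar> * real t + \<bar>a\<bar>)"
      by (simp add: Z_def flip: exp_add)
    then show ?thesis by (auto simp: G_def V_def Z_def)
  qed
  have split: "ennreal (Z (Suc t) \<omega>) = ennreal (G \<omega>) * ennreal (exp (a * Y (Suc t) \<omega>))
      + ennreal ((1 - V \<omega>) * Z t \<omega>)" for \<omega>
  proof -
    have "hits p (Suc t) \<omega> = hits p t \<omega> + V \<omega>"
      by (simp add: hits_def V_def)
    moreover have "dev p (Suc t) \<omega> = dev p t \<omega> + V \<omega> * (Y (Suc t) \<omega> - f (X (Suc t) \<omega>))"
      by (simp add: dev_def V_def)
    moreover have "V \<omega> = 0 \<or> V \<omega> = 1" by (simp add: V_def)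
    ultimately have "Z (Suc t) \<omega> = G \<omega> * exp (a * Y (Suc t) \<omega>) + (1 - V \<omega>) * Z t \<omega>"
      by (auto simp: Z_def G_def ring_distribs add_divide_distrib simp flip: exp_add)
    moreover have "0 \<le> G \<omega>" "0 \<le> (1 - V \<omega>) * Z t \<omega>"
      by (auto simp: G_def V_def Z_def)
    ultimately show ?thesis by (simp add: ennreal_mult)
  qed
  have "(\<integral>\<^sup>+\<omega>. ennreal (Z (Suc t) \<omega>) \<partial>M)
      = (\<integral>\<^sup>+\<omega>. ennreal (G \<omega>) * ennreal (exp (a * Y (Suc t) \<omega>)) \<partial>M)
        + (\<integral>\<^sup>+\<omega>. ennreal ((1 - V \<omega>) * Z t \<omega>) \<partial>M)"
    unfolding split by (intro nn_integral_add) auto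
  also have "(\<integral>\<^sup>+\<omega>. ennreal (G \<omega>) * ennreal (exp (a * Y (Suc t) \<omega>)) \<partial>M)
      = (\<integral>\<^sup>+\<omega>. ennreal (G \<omega>) * (\<integral>\<^sup>+y. ennreal (exp (a * y)) \<partial>K (X (Suc t) \<omega>)) \<partial>M)"
    by (rule reward_conditional_law[OF _ G Gle]) auto
  also have "\<dots> \<le> (\<integral>\<^sup>+\<omega>. ennreal (V \<omega> * Z t \<omega>) \<partial>M)"
  proof (rule nn_integral_mono)
    fix \<omega> assume \<omega>: "\<omega> \<in> space M"
    define x where "x = X (Suc t) \<omega>"
    have x: "x \<in> space A" using X_space \<omega> by (simp add: x_def)
    have "(\<integral>\<^sup>+y. ennreal (exp (a * y)) \<partial>K x)
        = (\<integral>\<^sup>+y. ennreal (exp (a * f x)) * ennreal (exp (a * (y - f x))) \<partial>K x)"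
      by (intro nn_integral_cong) (simp add: algebra_simps flip: ennreal_mult exp_add)
    also have "\<dots> = ennreal (exp (a * f x)) * (\<integral>\<^sup>+y. ennreal (exp (a * (y - f x))) \<partial>K x)"
      using reward_law(2)[OF x] by (intro nn_integral_cmult) (simp cong: measurable_cong_sets)
    also have "\<dots> \<le> ennreal (exp (a * f x)) * ennreal (exp (a\<^sup>2 / 8))"
      by (intro mult_left_mono reward_mgf_le x) simp
    finally have "ennreal (G \<omega>) * (\<integral>\<^sup>+y. ennreal (exp (a * y)) \<partial>K x)
        \<le> ennreal (G \<omega>) * (ennreal (exp (a * f x)) * ennreal (exp (a\<^sup>2 / 8)))"
      by (intro mult_left_mono) auto
    also have "\<dots> = ennreal (G \<omega> * (exp (a * f x) * exp (a\<^sup>2 / 8)))"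
      using Gle[OF \<omega>] by (simp flip: ennreal_mult)
    also have "exp (- a * f x - a\<^sup>2 / 8) * (exp (a * f x) * exp (a\<^sup>2 / 8)) = 1"
      by (simp flip: exp_add)
    then have "G \<omega> * (exp (a * f x) * exp (a\<^sup>2 / 8)) = V \<omega> * Z t \<omega>"
      by (simp add: G_def x_def mult.assoc)
    finally show "ennreal (G \<omega>) * (\<integral>\<^sup>+y. ennreal (exp (a * y)) \<partial>K (X (Suc t) \<omega>))
        \<le> ennreal (V \<omega> * Z t \<omega>)" by (simp add: x_def)
  qed
  also have "(\<integral>\<^sup>+\<omega>. ennreal (V \<omega> * Z t \<omega>) \<partial>M) + (\<integral>\<^sup>+\<omega>. ennreal ((1 - V \<omega>) * Z t \<omega>) \<partial>M)
      = (\<integral>\<^sup>+\<omega>. ennreal (V \<omega> * Z t \<omega>) + ennreal ((1 - V \<omega>) * Z t \<omega>) \<partial>M)"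
    by (intro nn_integral_add[symmetric]) auto
  also have "\<dots> = (\<integral>\<^sup>+\<omega>. ennreal (Z t \<omega>) \<partial>M)"
    by (intro nn_integral_cong) (auto simp: V_def)
  also have "\<dots> \<le> 1" using Suc.IH by (simp add: Z_def)
  finally show ?case by (simp add: Z_def)
qed

end

subsection \<open>The partition\<close>

text \<open>The path of cells containing \<open>x\<close>. Turning right is the default, correct for
  a point of the parent cell because the two children cover it.\<close>

primrec opt_index :: "(nat \<Rightarrow> nat \<Rightarrow> 'x set) \<Rightarrow> 'x \<Rightarrow> nat \<Rightarrow> nat" where
  "opt_index cell x 0 = 0"
| "opt_index cell x (Suc h) =
     (if x \<in> cell (h + 1) (2 * opt_index cell x h) then 2 * opt_index cell x h
      else 2 * opt_index cell x h + 1)"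

lemma opt_index_child: "(Suc h, opt_index cell x (Suc h)) \<in> children (h, opt_index cell x h)"
  by (simp add: children_def)

context hierarchical_bandit
begin

abbreviation "opt \<equiv> opt_index cell xstar"

lemma opt: "opt h < 2 ^ h \<and> xstar \<in> cell h (opt h)"
proof (induction h)
  case 0
  show ?case by (simp add: cell_root xstar_in)
next
  case (Suc h)
  then show ?case using cell_split[of "opt h" h] by auto
qed

lemma cell_anc:
  assumes "snd q < 2 ^ fst q" "k \<le> fst q"
  shows "cell (fst q) (snd q) \<subseteq> cell k (snd (anc k q))"
  using assms(2)
proof (induction rule: inc_induct)
  case base
  show ?case by simp
next
  case (step k)
  have "k < fst q" using step by simp
  from anc_Suc_child[OF this]
  have "snd (anc (Suc k) q) \<in> {2 * snd (anc k q), 2 * snd (anc k q) + 1}"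
    unfolding children_def by (cases "anc (Suc k) q") auto
  moreover have "snd (anc k q) < 2 ^ k" using anc_index[OF assms(1), of k] \<open>k < fst q\<close> by simp
  note cell_split[OF this]
  ultimately have "cell (Suc k) (snd (anc (Suc k) q)) \<subseteq> cell k (snd (anc k q))"
    by (metis Suc_eq_plus1 Un_upper1 Un_upper2 empty_iff insert_iff)
  with step.IH show ?case by (rule order_trans)
qed

lemma cell_subset_space: "i < 2 ^ h \<Longrightarrow> cell h i \<subseteq> space A"
  using cell_anc[of "(h, i)" 0] by (simp add: anc_def cell_root)

lemma l_le_diam:
  assumes "i < 2 ^ h" "x \<in> cell h i" "x' \<in> cell h i"
  shows "l x x' \<le> \<nu>1 * \<rho> ^ h"
proof -
  have "ereal (l x x') \<le> semi_diam l (cell h i)"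
    unfolding semi_diam_def by (rule SUP_upper2[OF assms(2)], rule SUP_upper2[OF assms(3)]) simp
  also have "\<dots> \<le> ereal (\<nu>1 * \<rho> ^ h)" using A2 assms(1) by blast
  finally show ?thesis by simp
qed

text \<open>(A3) based at \<open>xstar\<close>, whose own gap is 0, leaves only the distance, which
  the diameter of the cell bounds.\<close>

lemma opt_gap: "x \<in> cell h (opt h) \<Longrightarrow> f xstar - f x \<le> \<nu>1 * \<rho> ^ h"
proof -
  assume x: "x \<in> cell h (opt h)"
  then have "x \<in> space A" using cell_subset_space opt by blast
  then have "f xstar - f x \<le> max 0 (l xstar x)"
    using A3[OF xstar_in, of x] by simp
  also have "\<dots> \<le> \<nu>1 * \<rho> ^ h"
    using l_le_diam[of "opt h" h xstar x] opt x constants by simp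
  finally show ?thesis .
qed

text \<open>In a cell that fails this test every point loses more than
  \<open>2 * \<nu>1 * \<rho> ^ h\<close>. One half is offset by the diameter term of
  \<open>u_value\<close>; the other is a margin that exploration bonus and noise must
  overcome.\<close>

definition near_nodes :: "nat \<Rightarrow> nat set" where
  "near_nodes h = {i. i < 2 ^ h \<and> (\<exists>x\<in>cell h i. f x \<ge> f xstar - 2 * \<nu>1 * \<rho> ^ h)}"

text \<open>Indexed by the depth of the parent, one less than that of its nodes: the near-optimal
  parent controls both the loss below a fringe node and the number of such nodes.\<close>

definition fringe :: "nat \<Rightarrow> node set" where
  "fringe h = {p. snd p \<notin> near_nodes (Suc h) \<and> (\<exists>i\<in>near_nodes h. p \<in> children (h, i))}"

lemma finite_near_nodes: "finite (near_nodes h)"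
  by (rule finite_subset[of _ "{..<2 ^ h}"]) (auto simp: near_nodes_def)

lemma fringe_subset: "fringe h \<subseteq> (\<Union>i\<in>near_nodes h. {(Suc h, 2 * i), (Suc h, 2 * i + 1)})"
  by (auto simp: fringe_def children_def)

lemma finite_fringe: "finite (fringe h)"
  by (rule finite_subset[OF fringe_subset]) (simp add: finite_near_nodes)

lemma card_fringe: "card (fringe h) \<le> 2 * card (near_nodes h)"
proof -
  have "card (fringe h) \<le> card (\<Union>i\<in>near_nodes h. {(Suc h, 2 * i), (Suc h, 2 * i + 1)})"
    by (rule card_mono[OF _ fringe_subset]) (simp add: finite_near_nodes)
  also have "\<dots> \<le> (\<Sum>i\<in>near_nodes h. card {(Suc h, 2 * i), (Suc h, 2 * i + 1)})"
    by (rule card_UN_le[OF finite_near_nodes])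
  also have "\<dots> = 2 * card (near_nodes h)" by simp
  finally show ?thesis .
qed

lemma opt_near: "opt h \<in> near_nodes h"
proof -
  have "0 \<le> 2 * \<nu>1 * \<rho> ^ h" using constants by simp
  then show ?thesis using opt[of h] by (auto simp: near_nodes_def intro!: bexI[of _ xstar])
qed

text \<open>With \<open>w = \<nu>1 * \<rho> ^ h\<close>, applying (A3) at a
  \<open>2 * w\<close>-optimal point of the cell gives the bound
  \<open>2 * w + max (2 * w) w\<close>.\<close>

lemma near_gap:
  assumes "i \<in> near_nodes h" "x \<in> cell h i"
  shows "f xstar - f x \<le> 4 * \<nu>1 * \<rho> ^ h"
proof -
  obtain z where z: "i < 2 ^ h" "z \<in> cell h i" "f z \<ge> f xstar - 2 * \<nu>1 * \<rho> ^ h"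
    using assms(1) by (auto simp: near_nodes_def)
  then have "z \<in> space A" "x \<in> space A" using cell_subset_space assms(2) by blast+
  then have "f xstar - f x \<le> f xstar - f z + max (f xstar - f z) (l z x)" by (rule A3)
  moreover have "l z x \<le> \<nu>1 * \<rho> ^ h" using l_le_diam z assms(2) by blast
  moreover have "0 < \<nu>1 * \<rho> ^ h" using constants by simp
  ultimately show ?thesis using z(3) by (auto simp: max_def split: if_splits)
qed

text \<open>The balls of (A2) for near-optimal nodes are disjoint and contained in their cells,
  hence in the set of \<open>4 * \<nu>1 * \<rho> ^ h\<close>-optimal points: they form a
  packing.\<close>

lemma card_near_nodes:
  assumes pack: "\<And>\<epsilon>. 0 < \<epsilon> \<Longrightarrow> \<epsilon> \<le> \<nu>2 \<Longrightarrow>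
    packing_number (space A) l (near_optimal (space A) f xstar (4 * \<nu>1 / \<nu>2 * \<epsilon>)) \<epsilon>
      \<le> ereal (C * \<epsilon> powr (- d))"
  shows "real (card (near_nodes h)) \<le> C * (\<nu>2 * \<rho> ^ h) powr (- d)"
proof -
  obtain z where z: "\<And>h i. i < 2 ^ h \<Longrightarrow> z h i \<in> cell h i \<and>
        semi_ball (space A) l (z h i) (\<nu>2 * \<rho> ^ h) \<subseteq> cell h i \<and>
        (\<forall>j<2 ^ h. i \<noteq> j \<longrightarrow>
           semi_ball (space A) l (z h i) (\<nu>2 * \<rho> ^ h) \<inter>
           semi_ball (space A) l (z h j) (\<nu>2 * \<rho> ^ h) = {})"
    using A2 by metis
  \<comment> \<open>The ball radius at depth \<open>h\<close>. For it
    \<open>4 * \<nu>1 / \<nu>2 * \<epsilon>\<close> is the loss allowed by \<open>near_gap\<close>,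
    which explains the constants of the dimension.\<close>
  define \<epsilon> where "\<epsilon> = \<nu>2 * \<rho> ^ h"
  have \<epsilon>: "0 < \<epsilon>" "\<epsilon> \<le> \<nu>2" using constants by (auto simp: \<epsilon>_def power_le_one)
  define U where "U = near_optimal (space A) f xstar (4 * \<nu>1 / \<nu>2 * \<epsilon>)"
  have sub: "cell h i \<subseteq> U" if "i \<in> near_nodes h" for i
  proof
    fix x assume "x \<in> cell h i"
    moreover have "i < 2 ^ h" using that by (simp add: near_nodes_def)
    ultimately show "x \<in> U"
      using near_gap[OF that] cell_subset_space constants
      by (auto simp: U_def near_optimal_def \<epsilon>_def algebra_simps)
  qed
  obtain e where e: "bij_betw e {0..<card (near_nodes h)} (near_nodes h)"
    using ex_bij_betw_nat_finite[OF finite_near_nodes] by blast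
  have en: "e k \<in> near_nodes h" "e k < 2 ^ h" if "k < card (near_nodes h)" for k
    using bij_betwE[OF e] that by (auto simp: near_nodes_def)
  have "is_packing (space A) l U \<epsilon> (card (near_nodes h)) (\<lambda>k. z h (e k))"
    unfolding is_packing_def
  proof (intro conjI allI impI)
    fix k assume k: "k < card (near_nodes h)"
    show "z h (e k) \<in> U" "semi_ball (space A) l (z h (e k)) \<epsilon> \<subseteq> U"
      using z[OF en(2)[OF k]] sub[OF en(1)[OF k]] unfolding \<epsilon>_def by blast+
  next
    fix j k assume jk: "j < card (near_nodes h)" "k < card (near_nodes h)" "j \<noteq> k"
    then have "e j \<noteq> e k" using bij_betw_imp_inj_on[OF e] by (auto dest: inj_onD)
    then show "semi_ball (space A) l (z h (e j)) \<epsilon> \<inter> semi_ball (space A) l (z h (e k)) \<epsilon> = {}"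
      using z[OF en(2)[OF jk(1)]] en(2)[OF jk(2)] unfolding \<epsilon>_def by blast
  qed
  then have "ereal (real (card (near_nodes h))) \<le> packing_number (space A) l U \<epsilon>"
    unfolding packing_number_def by (intro SUP_upper) auto
  also have "\<dots> \<le> ereal (C * \<epsilon> powr (- d))" using pack[OF \<epsilon>] by (simp add: U_def)
  finally show ?thesis by (simp add: \<epsilon>_def)
qed

end

subsection \<open>Visits of suboptimal nodes\<close>

text \<open>Telescoping; the induction carries the remainder
  \<open>1 / real (Suc m)\<close>.\<close>

lemma sum_inverse_squares_le: "(\<Sum>t=1..n. 1 / real t ^ 2) \<le> 2"
proof (cases n)
  case (Suc m)
  have "(\<Sum>t=1..Suc m. 1 / real t ^ 2) \<le> 2 - 1 / real (Suc m)"
  proof (induction m)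
    case 0
    show ?case by simp
  next
    case (Suc m)
    define x where "x = real (Suc m)"
    have "0 < x" by (simp add: x_def)
    then have "1 / (x + 1) ^ 2 \<le> 1 / (x * (x + 1))"
      by (intro divide_left_mono) (simp_all add: power2_eq_square)
    also have "\<dots> = 1 / x - 1 / (x + 1)"
      using \<open>0 < x\<close> by (simp add: divide_simps)
    finally have "1 / real (Suc (Suc m)) ^ 2 \<le> 1 / real (Suc m) - 1 / real (Suc (Suc m))"
      by (simp add: x_def add.commute)
    then show ?case using Suc by (subst sum.cl_ivl_Suc) simp
  qed
  also have "\<dots> \<le> 2" by simp
  finally show ?thesis using Suc by simp
qed simp

context ld_hoo_run
begin

lemma path: "\<omega> \<in> space M \<Longrightarrow> ld_hoo_path \<nu>1 \<rho> H (\<lambda>\<tau>. N \<tau> \<omega>) (\<lambda>\<tau>. Y \<tau> \<omega>)"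
  by unfold_locales (rule N_select)

text \<open>Fixing the number of visits to be \<open>m\<close> makes the optimal exponent in Chernoff's bound
  deterministic, so that no stopping times are needed.\<close>

lemma fixed_count_tail:
  assumes "1 \<le> t" "1 \<le> m" "\<sigma> = 1 \<or> \<sigma> = -1"
  shows "prob {\<omega> \<in> space M. hits p u \<omega> = real m \<and> sqrt (2 * real m * ln (real t)) \<le> \<sigma> * dev p u \<omega>}
    \<le> 1 / real t ^ 4"
proof -
  let ?E = "{\<omega> \<in> space M. hits p u \<omega> = real m \<and> sqrt (2 * real m * ln (real t)) \<le> \<sigma> * dev p u \<omega>}"
  define L where "L = ln (real t)"
  define r where "r = sqrt (2 * real m * L)"
  \<comment> \<open>Up to the sign \<sigma>, which selects the tail, this \<open>a\<close> maximises
    \<open>a * r - a\<^sup>2 / 8 * real m\<close>. The maximum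
    \<open>2 * r\<^sup>2 / real m = 4 * L\<close> yields the fourth power of
    \<open>t\<close>.\<close>
  define a where "a = \<sigma> * (4 * r / real m)"
  define Z where "Z = (\<lambda>\<omega>. exp (a * dev p u \<omega> - a\<^sup>2 / 8 * hits p u \<omega>))"
  have L: "0 \<le> L" "exp (4 * L) = real t ^ 4"
    using assms(1) by (auto simp: L_def exp_of_nat_mult[of 4, simplified])
  have r: "0 \<le> r" "r\<^sup>2 = 2 * real m * L" using L by (auto simp: r_def)
  have "Z \<omega> \<ge> real t ^ 4" if "\<omega> \<in> ?E" for \<omega>
  proof -
    have "4 * r / real m * r \<le> 4 * r / real m * (\<sigma> * dev p u \<omega>)"
      using that r by (intro mult_left_mono) (auto simp: r_def L_def)
    moreover have "4 * r / real m * r = 8 * L"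
      using r(2) assms(2) by (simp add: power2_eq_square field_simps)
    moreover have "a\<^sup>2 / 8 * real m = 4 * L"
      using r(2) assms(2,3) by (auto simp: a_def power_mult_distrib power_divide power2_eq_square
          field_simps)
    moreover have "a * dev p u \<omega> = 4 * r / real m * (\<sigma> * dev p u \<omega>)" by (simp add: a_def)
    ultimately have "4 * L \<le> a * dev p u \<omega> - a\<^sup>2 / 8 * hits p u \<omega>" using that by simp
    then show ?thesis by (simp add: Z_def L(2)[symmetric])
  qed
  then have "?E \<subseteq> {\<omega> \<in> space M. 1 \<le> ennreal (1 / real t ^ 4) * ennreal (Z \<omega>)}"
    using assms(1) by (auto simp: Z_def le_divide_eq simp flip: ennreal_mult)
  then have "emeasure M ?E \<le> emeasure M {\<omega> \<in> space M. 1 \<le> ennreal (1 / real t ^ 4) * ennreal (Z \<omega>)}"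
    by (intro emeasure_mono) (auto simp: Z_def)
  also have "\<dots> \<le> ennreal (1 / real t ^ 4) * (\<integral>\<^sup>+\<omega>. ennreal (Z \<omega>) * indicator (space M) \<omega> \<partial>M)"
    by (rule nn_integral_Markov_inequality) (auto simp: Z_def)
  also have "\<dots> \<le> ennreal (1 / real t ^ 4) * 1"
  proof (rule mult_left_mono)
    have "(\<integral>\<^sup>+\<omega>. ennreal (Z \<omega>) * indicator (space M) \<omega> \<partial>M) = (\<integral>\<^sup>+\<omega>. ennreal (Z \<omega>) \<partial>M)"
      by (rule nn_integral_cong) simp
    then show "(\<integral>\<^sup>+\<omega>. ennreal (Z \<omega>) * indicator (space M) \<omega> \<partial>M) \<le> 1"
      using supermartingale[of a p u] by (simp add: Z_def)
  qed simp
  finally show ?thesis by (simp add: emeasure_eq_measure)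
qed

text \<open>The rewards are too high for \<open>\<sigma> = 1\<close> and too low for
  \<open>\<sigma> = -1\<close>. The threshold is the exploration bonus of \<open>u_value\<close>
  multiplied by the number of visits.\<close>

definition deviates :: "real \<Rightarrow> nat \<Rightarrow> node \<Rightarrow> 'w set" where
  "deviates \<sigma> t p = {\<omega> \<in> space M. 0 < hits p (t - 1) \<omega> \<and>
     sqrt (2 * hits p (t - 1) \<omega> * ln (real t)) \<le> \<sigma> * dev p (t - 1) \<omega>}"

lemma deviates_measurable [measurable]: "deviates \<sigma> t p \<in> events"
  unfolding deviates_def by measurable

text \<open>The number of visits is random, but if positive it lies in \<open>{1..t - 1}\<close>; a
  union bound over its value reduces to fixed counts.\<close>

lemma prob_deviates:
  assumes "1 \<le> t" "\<sigma> = 1 \<or> \<sigma> = -1"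
  shows "prob (deviates \<sigma> t p) \<le> real (t - 1) / real t ^ 4"
proof -
  let ?E = "\<lambda>m. {\<omega> \<in> space M. hits p (t - 1) \<omega> = real m \<and>
    sqrt (2 * real m * ln (real t)) \<le> \<sigma> * dev p (t - 1) \<omega>}"
  have "deviates \<sigma> t p \<subseteq> (\<Union>m\<in>{1..t - 1}. ?E m)"
  proof
    fix \<omega> assume \<omega>: "\<omega> \<in> deviates \<sigma> t p"
    let ?m = "visit_count (\<lambda>\<tau>. N \<tau> \<omega>) (t - 1) p"
    have "hits p (t - 1) \<omega> = real ?m" by (rule hits_eq_visit_count)
    moreover from this have "?m \<in> {1..t - 1}"
      using \<omega> hits_bounds(2)[of p "t - 1" \<omega>] by (simp add: deviates_def)
    ultimately show "\<omega> \<in> (\<Union>m\<in>{1..t - 1}. ?E m)"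
      using \<omega> by (intro UN_I[of ?m]) (simp_all add: deviates_def)
  qed
  then have "prob (deviates \<sigma> t p) \<le> prob (\<Union>m\<in>{1..t - 1}. ?E m)"
    by (intro finite_measure_mono) auto
  also have "\<dots> \<le> (\<Sum>m\<in>{1..t - 1}. prob (?E m))"
    by (intro finite_measure_subadditive_finite) auto
  also have "\<dots> \<le> (\<Sum>m\<in>{1..t - 1}. 1 / real t ^ 4)"
    using assms by (intro sum_mono fixed_count_tail) auto
  finally show ?thesis by simp
qed

text \<open>The deviations that can make the algorithm return to a suboptimal node \<open>p\<close>
  already visited often: \<open>p\<close> looks too good, or some node of the optimal path too
  poor.\<close>

definition bad :: "nat \<Rightarrow> node \<Rightarrow> 'w set" where
  "bad t p = deviates 1 t p \<union> (\<Union>j\<in>{1..<t}. deviates (-1) t (j, opt j))"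

lemma bad_measurable [measurable]: "bad t p \<in> events"
  unfolding bad_def by measurable

text \<open>At most \<open>t\<close> deviations, each of probability at most
  \<open>real (t - 1) / real t ^ 4\<close>. The fourth power pays for the unions over counts and
  over depths and still leaves a summable bound.\<close>

lemma prob_bad:
  assumes "1 \<le> t"
  shows "prob (bad t p) \<le> 1 / real t ^ 2"
proof -
  have "prob (bad t p) \<le> prob (deviates 1 t p) + prob (\<Union>j\<in>{1..<t}. deviates (-1) t (j, opt j))"
    unfolding bad_def by (intro measure_Un_le) auto
  also have "\<dots> \<le> prob (deviates 1 t p) + (\<Sum>j\<in>{1..<t}. prob (deviates (-1) t (j, opt j)))"
    by (intro add_left_mono finite_measure_subadditive_finite) auto
  also have "\<dots> \<le> real (t - 1) / real t ^ 4 + (\<Sum>j\<in>{1..<t}. real (t - 1) / real t ^ 4)"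
    using assms by (intro add_mono sum_mono prob_deviates) auto
  also have "\<dots> = real t * real (t - 1) / real t ^ 4"
    using assms by (simp add: of_nat_diff field_simps)
  also have "\<dots> \<le> real t * real t / real t ^ 4"
    by (intro divide_right_mono mult_left_mono) auto
  also have "\<dots> = 1 / real t ^ 2"
    using assms by (simp add: power2_eq_square power4_eq_xxxx)
  finally show ?thesis .
qed

section \<open>Index values and the payoffs in visited cells\<close>

lemma X_in_ancestor_cell:
  assumes "\<omega> \<in> space M" "1 \<le> t" "descends p (N t \<omega>)"
  shows "X t \<omega> \<in> cell (fst p) (snd p)" "snd p < 2 ^ fst p"
proof -
  interpret path: ld_hoo_path \<nu>1 \<rho> H "\<lambda>\<tau>. N \<tau> \<omega>" "\<lambda>\<tau>. Y \<tau> \<omega>" using path[OF assms(1)] .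
  have "snd (N t \<omega>) < 2 ^ fst (N t \<omega>)" using path.selected_index assms(2) .
  then show "X t \<omega> \<in> cell (fst p) (snd p)" "snd p < 2 ^ fst p"
    using X_in_cell[OF assms(2,1)] cell_anc[of "N t \<omega>" "fst p"] anc_index[of "N t \<omega>" "fst p"] assms(3)
    by (auto simp: descends_iff)
qed

text \<open>Separates noise from payoffs and puts the bonus over the common denominator
  \<open>T\<close>, the form from which \<open>deviates\<close> can be read off.\<close>

lemma u_value_eq:
  assumes "0 < hits p (t - 1) \<omega>"
  defines "T \<equiv> hits p (t - 1) \<omega>"
  shows "u_value \<nu>1 \<rho> (\<lambda>\<tau>. N \<tau> \<omega>) (\<lambda>\<tau>. Y \<tau> \<omega>) t p =
    ereal ((dev p (t - 1) \<omega> + (\<Sum>\<tau>\<in>visits (\<lambda>\<tau>. N \<tau> \<omega>) (t - 1) p. f (X \<tau> \<omega>))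
       + sqrt (2 * T * ln (real t))) / T + \<nu>1 * \<rho> ^ fst p)"
proof -
  have "sqrt (2 * T * ln (real t)) / T = sqrt (2 * ln (real t) / T)"
    using assms(1) by (simp add: T_def real_sqrt_mult real_sqrt_divide field_simps)
  moreover have "T = real (visit_count (\<lambda>\<tau>. N \<tau> \<omega>) (t - 1) p)"
    by (simp add: T_def hits_eq_visit_count)
  moreover have "visit_count (\<lambda>\<tau>. N \<tau> \<omega>) (t - 1) p \<noteq> 0"
    using assms(1) by (simp add: hits_eq_visit_count)
  ultimately show ?thesis
    by (simp add: u_value_def mean_reward_def dev_eq_sum_visits sum_subtractf add_divide_distrib)
qed

text \<open>By \<open>opt_gap\<close> the payoffs of the visits average at least
  \<open>f xstar\<close> minus the diameter term. So without noise \<open>u_value\<close> would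
  exceed \<open>f xstar\<close> by the bonus, and the noise must cancel at least that much.\<close>

lemma optimal_underestimated:
  assumes \<omega>: "\<omega> \<in> space M" and T: "0 < hits (j, opt j) (t - 1) \<omega>"
    and u: "u_value \<nu>1 \<rho> (\<lambda>\<tau>. N \<tau> \<omega>) (\<lambda>\<tau>. Y \<tau> \<omega>) t (j, opt j) \<le> ereal (f xstar)"
  shows "\<omega> \<in> deviates (-1) t (j, opt j)"
proof -
  define T where "T = hits (j, opt j) (t - 1) \<omega>"
  define V where "V = visits (\<lambda>\<tau>. N \<tau> \<omega>) (t - 1) (j, opt j)"
  have "T * (f xstar - \<nu>1 * \<rho> ^ j) = (\<Sum>\<tau>\<in>V. f xstar - \<nu>1 * \<rho> ^ j)"
    by (simp add: T_def V_def hits_eq_visit_count visit_count_def)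
  also have "\<dots> \<le> (\<Sum>\<tau>\<in>V. f (X \<tau> \<omega>))"
  proof (rule sum_mono)
    fix \<tau> assume "\<tau> \<in> V"
    then have "X \<tau> \<omega> \<in> cell j (opt j)"
      using X_in_ancestor_cell(1)[OF \<omega>, of \<tau> "(j, opt j)"] by (auto simp: V_def visits_def)
    then show "f xstar - \<nu>1 * \<rho> ^ j \<le> f (X \<tau> \<omega>)" using opt_gap[of _ j] by fastforce
  qed
  finally have "T * (f xstar - \<nu>1 * \<rho> ^ j) \<le> (\<Sum>\<tau>\<in>V. f (X \<tau> \<omega>))" .
  moreover have "(dev (j, opt j) (t - 1) \<omega> + (\<Sum>\<tau>\<in>V. f (X \<tau> \<omega>)) + sqrt (2 * T * ln (real t))) / T
      \<le> f xstar - \<nu>1 * \<rho> ^ j"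
    using u by (simp add: u_value_eq[OF T] T_def V_def)
  then have "dev (j, opt j) (t - 1) \<omega> + (\<Sum>\<tau>\<in>V. f (X \<tau> \<omega>)) + sqrt (2 * T * ln (real t))
      \<le> T * (f xstar - \<nu>1 * \<rho> ^ j)"
    using T by (simp add: T_def pos_divide_le_eq mult.commute)
  ultimately show ?thesis using \<omega> T by (simp add: deviates_def T_def)
qed

text \<open>The payoffs fall short of \<open>f xstar\<close> by \<open>2 * w\<close> per visit and
  the diameter term restores only \<open>w\<close>, so noise and bonus together exceed
  \<open>w\<close> per visit. After enough visits the bonus is at most half of \<open>w\<close>, and
  the noise alone exceeds the bonus.\<close>

lemma suboptimal_overestimated:
  assumes \<omega>: "\<omega> \<in> space M" and t: "1 \<le> t" "t \<le> n" and T: "0 < hits p (t - 1) \<omega>"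
    and often: "8 * ln (real n) / (\<nu>1 * \<rho> ^ fst p)\<^sup>2 \<le> hits p (t - 1) \<omega>"
    and p: "snd p \<notin> near_nodes (fst p)"
    and u: "ereal (f xstar) < u_value \<nu>1 \<rho> (\<lambda>\<tau>. N \<tau> \<omega>) (\<lambda>\<tau>. Y \<tau> \<omega>) t p"
  shows "\<omega> \<in> deviates 1 t p"
proof -
  define T where "T = hits p (t - 1) \<omega>"
  define V where "V = visits (\<lambda>\<tau>. N \<tau> \<omega>) (t - 1) p"
  define w where "w = \<nu>1 * \<rho> ^ fst p"
  have w: "0 < w" using constants by (simp add: w_def)
  have "(\<Sum>\<tau>\<in>V. f (X \<tau> \<omega>)) \<le> (\<Sum>\<tau>\<in>V. f xstar - 2 * w)"
  proof (rule sum_mono)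
    fix \<tau> assume "\<tau> \<in> V"
    then have "X \<tau> \<omega> \<in> cell (fst p) (snd p)" "snd p < 2 ^ fst p"
      using X_in_ancestor_cell[OF \<omega>, of \<tau> p] by (auto simp: V_def visits_def)
    then show "f (X \<tau> \<omega>) \<le> f xstar - 2 * w"
      using p by (fastforce simp: near_nodes_def w_def)
  qed
  also have "\<dots> = T * (f xstar - 2 * w)"
    by (simp add: T_def V_def hits_eq_visit_count visit_count_def)
  finally have "(\<Sum>\<tau>\<in>V. f (X \<tau> \<omega>)) \<le> T * (f xstar - 2 * w)" .
  moreover have "f xstar - w < (dev p (t - 1) \<omega> + (\<Sum>\<tau>\<in>V. f (X \<tau> \<omega>)) + sqrt (2 * T * ln (real t))) / T"
    using u by (simp add: u_value_eq[OF T] T_def V_def w_def)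
  then have "T * (f xstar - w) < dev p (t - 1) \<omega> + (\<Sum>\<tau>\<in>V. f (X \<tau> \<omega>)) + sqrt (2 * T * ln (real t))"
    using T by (simp add: T_def pos_less_divide_eq mult.commute)
  ultimately have "T * w < dev p (t - 1) \<omega> + sqrt (2 * T * ln (real t))"
    by (simp add: algebra_simps)
  \<comment> \<open>Source of the constant 8: twice the bonus is at most \<open>w\<close> once
    \<open>T\<close> reaches \<open>8 * ln (real t) / w\<^sup>2\<close>.\<close>
  moreover have "2 * sqrt (2 * T * ln (real t)) \<le> T * w"
  proof (rule power2_le_imp_le)
    have "8 * ln (real n) / w\<^sup>2 \<le> T" using often by (simp add: T_def w_def)
    then have "8 * ln (real n) \<le> T * w\<^sup>2" using w by (simp add: pos_divide_le_eq)
    moreover have "ln (real t) \<le> ln (real n)" using t by simp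
    ultimately have "T * (8 * ln (real t)) \<le> T * (T * w\<^sup>2)"
      using T by (intro mult_left_mono) (auto simp: T_def)
    moreover have "(2 * sqrt (2 * T * ln (real t)))\<^sup>2 = T * (8 * ln (real t))"
      using T t by (simp add: T_def power_mult_distrib)
    moreover have "(T * w)\<^sup>2 = T * (T * w\<^sup>2)" by (simp add: power2_eq_square)
    ultimately show "(2 * sqrt (2 * T * ln (real t)))\<^sup>2 \<le> (T * w)\<^sup>2" by simp
    show "0 \<le> T * w" using T w by (simp add: T_def)
  qed
  ultimately show ?thesis using \<omega> T by (simp add: deviates_def T_def)
qed

lemma suboptimal_visit:
  assumes \<omega>: "\<omega> \<in> space M" and t: "1 \<le> t" "t \<le> n" and n: "2 \<le> n"
    and p: "snd p \<notin> near_nodes (fst p)" "descends p (N t \<omega>)"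
  shows "hits p (t - 1) \<omega> < 8 * ln (real n) / (\<nu>1 * \<rho> ^ fst p)\<^sup>2 \<or> \<omega> \<in> bad t p"
proof (rule ccontr)
  assume neg: "\<not> ?thesis"
  interpret path: ld_hoo_path \<nu>1 \<rho> H "\<lambda>\<tau>. N \<tau> \<omega>" "\<lambda>\<tau>. Y \<tau> \<omega>" using path[OF \<omega>] .
  \<comment> \<open>\<open>ln (real n)\<close> is positive for \<open>n \<ge> 2\<close>, so reaching
    the threshold already implies a visit and \<open>u_value\<close> is finite.\<close>
  have "0 < 8 * ln (real n) / (\<nu>1 * \<rho> ^ fst p)\<^sup>2" using n constants by simp
  then have T: "0 < hits p (t - 1) \<omega>" using neg by linarith
  have "snd p \<noteq> opt (fst p)" using p(1) opt_near by metis
  from path.selection_cause[OF t(1) opt_index.simps(1) opt_index_child p(2) this]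
  consider "ereal (f xstar) < u_value \<nu>1 \<rho> (\<lambda>\<tau>. N \<tau> \<omega>) (\<lambda>\<tau>. Y \<tau> \<omega>) t p"
    | j where "j \<in> {1..<t}" "visit_count (\<lambda>\<tau>. N \<tau> \<omega>) (t - 1) (j, opt j) \<noteq> 0"
      "u_value \<nu>1 \<rho> (\<lambda>\<tau>. N \<tau> \<omega>) (\<lambda>\<tau>. Y \<tau> \<omega>) t (j, opt j) \<le> ereal (f xstar)"
    by blast
  then show False
  proof cases
    case 1
    then have "\<omega> \<in> deviates 1 t p"
      using neg by (intro suboptimal_overestimated[OF \<omega> t T _ p(1)]) auto
    then show False using neg by (simp add: bad_def)
  next
    case 2
    then have "\<omega> \<in> deviates (-1) t (j, opt j)"
      by (intro optimal_underestimated[OF \<omega>]) (auto simp: hits_eq_visit_count)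
    then show False using neg 2(1) by (auto simp: bad_def)
  qed
qed

text \<open>A visit happens either while the count is below the threshold or in a bad round. The
  count strictly increases at visits, so the former number at most the threshold rounded up, whence
  the \<open>+ 1\<close>.\<close>

lemma hits_le_bad:
  assumes \<omega>: "\<omega> \<in> space M" and n: "2 \<le> n" and p: "snd p \<notin> near_nodes (fst p)"
  shows "hits p n \<omega> \<le> 8 * ln (real n) / (\<nu>1 * \<rho> ^ fst p)\<^sup>2 + 1 + (\<Sum>t=1..n. indicator (bad t p) \<omega>)"
proof -
  define L where "L = 8 * ln (real n) / (\<nu>1 * \<rho> ^ fst p)\<^sup>2"
  define R where "R = {t\<in>{1..n}. descends p (N t \<omega>) \<and> hits p (t - 1) \<omega> < L}"
  define B where "B = {t\<in>{1..n}. \<omega> \<in> bad t p}"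
  let ?v = "\<lambda>t. visit_count (\<lambda>\<tau>. N \<tau> \<omega>) (t - 1) p"
  have L: "0 \<le> L" using n by (simp add: L_def)
  have less: "?v t < ?v t'" if "t \<in> R" "t < t'" for t t'
    unfolding visit_count_def
  proof (rule psubset_card_mono)
    show "visits (\<lambda>\<tau>. N \<tau> \<omega>) (t - 1) p \<subset> visits (\<lambda>\<tau>. N \<tau> \<omega>) (t' - 1) p"
    proof
      show "visits (\<lambda>\<tau>. N \<tau> \<omega>) (t - 1) p \<subseteq> visits (\<lambda>\<tau>. N \<tau> \<omega>) (t' - 1) p"
        using that(2) by (auto simp: visits_def)
      have "t \<in> visits (\<lambda>\<tau>. N \<tau> \<omega>) (t' - 1) p" "t \<notin> visits (\<lambda>\<tau>. N \<tau> \<omega>) (t - 1) p"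
        using that by (auto simp: visits_def R_def)
      then show "visits (\<lambda>\<tau>. N \<tau> \<omega>) (t - 1) p \<noteq> visits (\<lambda>\<tau>. N \<tau> \<omega>) (t' - 1) p"
        by blast
    qed
  qed (simp add: visits_def)
  have inj: "inj_on ?v R"
  proof (rule inj_onI, rule ccontr)
    fix t t' assume "t \<in> R" "t' \<in> R" "?v t = ?v t'" "t \<noteq> t'"
    then show False using less[of t t'] less[of t' t] by (cases t t' rule: linorder_cases) auto
  qed
  \<comment> \<open>The counts before these visits are distinct natural numbers below
    \<open>L\<close>.\<close>
  have "?v ` R \<subseteq> {..<nat \<lceil>L\<rceil>}"
  proof
    fix m assume "m \<in> ?v ` R"
    then have "real m < L" by (auto simp: R_def hits_eq_visit_count)
    then show "m \<in> {..<nat \<lceil>L\<rceil>}" by simp linarith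
  qed
  then have "card R \<le> nat \<lceil>L\<rceil>" using card_inj_on_le[OF inj _ finite_lessThan] by simp
  then have R: "real (card R) \<le> L + 1" using L by linarith
  have "visits (\<lambda>\<tau>. N \<tau> \<omega>) n p \<subseteq> R \<union> B"
    using suboptimal_visit[OF \<omega> _ _ n p] by (auto simp: visits_def R_def B_def L_def)
  then have "card (visits (\<lambda>\<tau>. N \<tau> \<omega>) n p) \<le> card (R \<union> B)"
    by (rule card_mono[rotated]) (simp add: R_def B_def)
  also have "\<dots> \<le> card R + card B" by (rule card_Un_le)
  finally have "hits p n \<omega> \<le> real (card R) + real (card B)"
    by (simp add: hits_eq_visit_count visit_count_def)
  moreover have "real (card B) = (\<Sum>t=1..n. indicator (bad t p) \<omega>)"
    unfolding B_def by (simp add: indicator_def sum.If_cases Int_def)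
  ultimately show ?thesis using R by (simp add: L_def)
qed

lemma hits_integrable: "integrable M (hits p n)"
  using hits_bounds by (intro integrable_const_bound[where B = "real n"]) auto

text \<open>The constant 3 is 1 for rounding plus 2 for the summed probabilities of bad
  rounds.\<close>

lemma expectation_hits:
  assumes "2 \<le> n" "snd p \<notin> near_nodes (fst p)"
  shows "expectation (hits p n) \<le> 8 * ln (real n) / (\<nu>1 * \<rho> ^ fst p)\<^sup>2 + 3"
proof -
  let ?L = "8 * ln (real n) / (\<nu>1 * \<rho> ^ fst p)\<^sup>2"
  have int: "integrable M (indicator (bad t p) :: 'w \<Rightarrow> real)" for t
    by (intro integrable_real_indicator) (auto simp: less_top[symmetric])
  have "expectation (hits p n) \<le> expectation (\<lambda>\<omega>. ?L + 1 + (\<Sum>t=1..n. indicator (bad t p) \<omega>))"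
    using hits_le_bad[OF _ assms]
    by (intro integral_mono hits_integrable Bochner_Integration.integrable_add
        Bochner_Integration.integrable_sum int) auto
  also have "\<dots> = ?L + 1 + (\<Sum>t=1..n. prob (bad t p))"
    using int by (simp add: prob_space)
  also have "(\<Sum>t=1..n. prob (bad t p)) \<le> (\<Sum>t=1..n. 1 / real t ^ 2)"
    by (intro sum_mono prob_bad) auto
  also have "\<dots> \<le> 2" by (rule sum_inverse_squares_le)
  finally show ?thesis by simp
qed

end

subsection \<open>The regret bound\<close>

context ld_hoo_run
begin

text \<open>The round is charged to the selected node if all its ancestors are near-optimal, and
  otherwise to its topmost ancestor that is not.\<close>

lemma gap_round:
  assumes \<omega>: "\<omega> \<in> space M" and t: "1 \<le> t"
  shows "f xstar - f (X t \<omega>) \<le> 4 * \<nu>1 * \<rho> ^ H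
    + (\<Sum>h<H. 4 * \<nu>1 * \<rho> ^ h * (\<Sum>i\<in>near_nodes h. of_bool (N t \<omega> = (h, i))))
    + (\<Sum>h<H. 4 * \<nu>1 * \<rho> ^ h * (\<Sum>p\<in>fringe h. of_bool (descends p (N t \<omega>))))"
    (is "?g \<le> ?a + sum ?b _ + sum ?c _")
proof -
  interpret path: ld_hoo_path \<nu>1 \<rho> H "\<lambda>\<tau>. N \<tau> \<omega>" "\<lambda>\<tau>. Y \<tau> \<omega>" using path[OF \<omega>] .
  define q where "q = N t \<omega>"
  have q: "snd q < 2 ^ fst q" "fst q \<le> H"
    using path.selected_index path.selected_depth_le t by (auto simp: q_def)
  have gap: "?g \<le> 4 * \<nu>1 * \<rho> ^ k" if "k \<le> fst q" "snd (anc k q) \<in> near_nodes k" for k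
    using X_in_ancestor_cell(1)[OF \<omega> t, of "anc k q"] that near_gap[OF that(2)]
    by (simp add: q_def descends_anc)
  have a: "0 \<le> ?a" and b: "0 \<le> ?b h" and c: "0 \<le> ?c h" for h
    using constants by (auto intro!: mult_nonneg_nonneg sum_nonneg)
  then have sums: "0 \<le> sum ?b {..<H}" "0 \<le> sum ?c {..<H}" by (auto intro: sum_nonneg)
  show ?thesis
  proof (cases "\<forall>k\<le>fst q. snd (anc k q) \<in> near_nodes k")
    case True
    then have near: "snd q \<in> near_nodes (fst q)" and g: "?g \<le> 4 * \<nu>1 * \<rho> ^ fst q"
      using gap[of "fst q"] by auto
    show ?thesis
    proof (cases "fst q = H")
      case True
      then show ?thesis using g sums by simp
    next
      case False
      have "(1::real) = of_bool (N t \<omega> = (fst q, snd q))" by (simp add: q_def)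
      also have "\<dots> \<le> (\<Sum>i\<in>near_nodes (fst q). of_bool (N t \<omega> = (fst q, i)))"
        by (rule member_le_sum[OF near]) (auto simp: finite_near_nodes)
      finally have "4 * \<nu>1 * \<rho> ^ fst q * 1 \<le> ?b (fst q)"
        using constants by (intro mult_left_mono) auto
      also have "?b (fst q) \<le> sum ?b {..<H}"
        using False q b by (intro member_le_sum) auto
      finally show ?thesis using g a sums by linarith
    qed
  next
    case False
    \<comment> \<open>The first depth at which near-optimality fails. It is not 0 since the root
      contains the optimum, so a parent at depth \<open>j\<close> exists; its near-optimality bounds
      the loss.\<close>
    define k where "k = (LEAST k. k \<le> fst q \<and> snd (anc k q) \<notin> near_nodes k)"
    have k: "k \<le> fst q \<and> snd (anc k q) \<notin> near_nodes k"
      unfolding k_def by (rule LeastI_ex) (use False in blast)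
    have "snd (anc 0 q) = opt 0" using q by (simp add: anc_def)
    then have "k \<noteq> 0" using k opt_near[of 0] by metis
    then obtain j where j: "k = Suc j" using not0_implies_Suc by blast
    then have "\<not> (j \<le> fst q \<and> snd (anc j q) \<notin> near_nodes j)"
      using not_less_Least[of j "\<lambda>k. k \<le> fst q \<and> snd (anc k q) \<notin> near_nodes k"]
      by (simp add: k_def)
    then have near: "snd (anc j q) \<in> near_nodes j" and jq: "j < fst q" using k j by auto
    have "anc k q \<in> children (j, snd (anc j q))"
      using anc_Suc_child[OF jq] by (simp add: j anc_def)
    then have fr: "anc k q \<in> fringe j" using near k j by (auto simp: fringe_def)
    have "(1::real) = of_bool (descends (anc k q) (N t \<omega>))"
      using k by (simp add: descends_anc q_def[symmetric])
    also have "\<dots> \<le> (\<Sum>p\<in>fringe j. of_bool (descends p (N t \<omega>)))"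
      by (rule member_le_sum[OF fr]) (auto simp: finite_fringe)
    finally have "4 * \<nu>1 * \<rho> ^ j * 1 \<le> ?c j"
      using constants by (intro mult_left_mono) auto
    also have "?c j \<le> sum ?c {..<H}"
      using jq q c by (intro member_le_sum) auto
    finally show ?thesis using gap[OF _ near] jq a sums by simp
  qed
qed

lemma sum_selected_le_1:
  assumes "\<omega> \<in> space M" "h < H"
  shows "(\<Sum>t=1..n. of_bool (N t \<omega> = (h, i))) \<le> (1 :: real)"
proof -
  interpret path: ld_hoo_path \<nu>1 \<rho> H "\<lambda>\<tau>. N \<tau> \<omega>" "\<lambda>\<tau>. Y \<tau> \<omega>" using path[OF assms(1)] .
  let ?S = "{t \<in> {1..n}. N t \<omega> = (h, i)}"
  have eq: "t = \<tau>" if "t \<in> ?S" "\<tau> \<in> ?S" for t \<tau>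
    using that path.selected_once[of t \<tau>] path.selected_once[of \<tau> t] assms(2)
    by (cases t \<tau> rule: linorder_cases) auto
  have "card ?S \<le> Suc 0" by (subst card_le_Suc0_iff_eq) (auto intro: eq)
  then show ?thesis by (simp add: of_bool_def sum.If_cases Int_def)
qed

text \<open>Sums \<open>gap_round\<close> over the rounds. The cost at the depth limit is charged in
  every round, each near-optimal node above it at most once, and each fringe node at every visit to
  its subtree.\<close>

lemma regret_le:
  assumes \<omega>: "\<omega> \<in> space M"
  shows "regret f xstar X n \<omega> \<le> 4 * \<nu>1 * \<rho> ^ H * real n
    + (\<Sum>h<H. 4 * \<nu>1 * \<rho> ^ h * (real (card (near_nodes h)) + (\<Sum>p\<in>fringe h. hits p n \<omega>)))"
proof -
  have "regret f xstar X n \<omega> = (\<Sum>t=1..n. f xstar - f (X t \<omega>))"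
    by (simp add: regret_def sum_subtractf)
  also have "\<dots> \<le> (\<Sum>t=1..n. 4 * \<nu>1 * \<rho> ^ H
    + (\<Sum>h<H. 4 * \<nu>1 * \<rho> ^ h * (\<Sum>i\<in>near_nodes h. of_bool (N t \<omega> = (h, i))))
    + (\<Sum>h<H. 4 * \<nu>1 * \<rho> ^ h * (\<Sum>p\<in>fringe h. of_bool (descends p (N t \<omega>)))))"
    by (intro sum_mono gap_round \<omega>) auto
  also have "\<dots> = 4 * \<nu>1 * \<rho> ^ H * real n
    + (\<Sum>t=1..n. \<Sum>h<H. 4 * \<nu>1 * \<rho> ^ h * (\<Sum>i\<in>near_nodes h. of_bool (N t \<omega> = (h, i))))
    + (\<Sum>t=1..n. \<Sum>h<H. 4 * \<nu>1 * \<rho> ^ h * (\<Sum>p\<in>fringe h. of_bool (descends p (N t \<omega>))))"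
    by (simp add: sum.distrib)
  also have "(\<Sum>t=1..n. \<Sum>h<H. 4 * \<nu>1 * \<rho> ^ h * (\<Sum>i\<in>near_nodes h. of_bool (N t \<omega> = (h, i))))
    = (\<Sum>h<H. 4 * \<nu>1 * \<rho> ^ h * (\<Sum>i\<in>near_nodes h. \<Sum>t=1..n. of_bool (N t \<omega> = (h, i))))"
    by (subst sum.swap) (simp only: sum_distrib_left[symmetric] sum.swap[of _ _ "{1..n}"])
  also have "(\<Sum>t=1..n. \<Sum>h<H. 4 * \<nu>1 * \<rho> ^ h * (\<Sum>p\<in>fringe h. of_bool (descends p (N t \<omega>))))
    = (\<Sum>h<H. 4 * \<nu>1 * \<rho> ^ h * (\<Sum>p\<in>fringe h. hits p n \<omega>))"
    unfolding hits_def
    by (subst sum.swap) (simp only: sum_distrib_left[symmetric] sum.swap[of _ _ "{1..n}"])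
  also have "(\<Sum>h<H. 4 * \<nu>1 * \<rho> ^ h * (\<Sum>i\<in>near_nodes h. \<Sum>t=1..n. of_bool (N t \<omega> = (h, i))))
    \<le> (\<Sum>h<H. 4 * \<nu>1 * \<rho> ^ h * (\<Sum>i\<in>near_nodes h. 1))"
    using constants by (intro sum_mono mult_left_mono sum_selected_le_1 \<omega>) auto
  finally show ?thesis by (simp add: sum.distrib ring_distribs)
qed

text \<open>Also guarantees that the expected regret is not the default value 0 of the
  integral.\<close>

lemma regret_integrable: "integrable M (regret f xstar X n)"
proof -
  have "integrable M (\<lambda>\<omega>. f (X t \<omega>))" if "1 \<le> t" for t
  proof (rule integrable_const_bound[where B = 1])
    show "AE \<omega> in M. norm (f (X t \<omega>)) \<le> 1" using f_bounds[OF X_space[OF that]] by auto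
    show "(\<lambda>\<omega>. f (X t \<omega>)) \<in> borel_measurable M"
      by (rule measurable_compose[OF X_measurable[OF that] f_measurable])
  qed
  then show ?thesis
    unfolding regret_def by (intro Bochner_Integration.integrable_diff
        Bochner_Integration.integrable_sum) auto
qed

lemma regret_nonneg: "\<omega> \<in> space M \<Longrightarrow> 0 \<le> regret f xstar X n \<omega>"
proof -
  assume \<omega>: "\<omega> \<in> space M"
  have "(\<Sum>t=1..n. f (X t \<omega>)) \<le> (\<Sum>t=1..n. f xstar)"
    using xstar_max X_space \<omega> by (intro sum_mono) auto
  then show ?thesis by (simp add: regret_def)
qed

text \<open>Each near-optimal node is charged once itself and has at most two fringe children at
  depth \<open>Suc h\<close>; \<open>expectation_hits\<close> for these gives
  \<open>1 + 2 * 3 = 7\<close> and \<open>2 * 8 = 16\<close>.\<close>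

lemma expected_regret:
  assumes n: "2 \<le> n"
  shows "expectation (regret f xstar X n) \<le> 4 * \<nu>1 * \<rho> ^ H * real n
    + (\<Sum>h<H. 4 * \<nu>1 * \<rho> ^ h * (real (card (near_nodes h))
        * (7 + 16 * ln (real n) / (\<nu>1 * \<rho> ^ Suc h)\<^sup>2)))"
proof -
  note int = Bochner_Integration.integrable_add Bochner_Integration.integrable_sum
    integrable_mult_right hits_integrable
  have "expectation (regret f xstar X n) \<le> expectation (\<lambda>\<omega>. 4 * \<nu>1 * \<rho> ^ H * real n
    + (\<Sum>h<H. 4 * \<nu>1 * \<rho> ^ h * (real (card (near_nodes h)) + (\<Sum>p\<in>fringe h. hits p n \<omega>))))"
    by (intro integral_mono regret_integrable regret_le int) auto
  also have "\<dots> = 4 * \<nu>1 * \<rho> ^ H * real n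
    + (\<Sum>h<H. 4 * \<nu>1 * \<rho> ^ h * (real (card (near_nodes h)) + (\<Sum>p\<in>fringe h. expectation (hits p n))))"
  proof -
    have "expectation (\<lambda>\<omega>. real (card (near_nodes h)) + (\<Sum>p\<in>fringe h. hits p n \<omega>))
      = real (card (near_nodes h)) + (\<Sum>p\<in>fringe h. expectation (hits p n))" for h
      by (simp add: hits_integrable prob_space)
    moreover have "integrable M (\<lambda>\<omega>. real (card (near_nodes h)) + (\<Sum>p\<in>fringe h. hits p n \<omega>))" for h
      by (intro int) auto
    ultimately show ?thesis by (simp add: prob_space)
  qed
  also have "\<dots> \<le> 4 * \<nu>1 * \<rho> ^ H * real n
    + (\<Sum>h<H. 4 * \<nu>1 * \<rho> ^ h * (real (card (near_nodes h))
        * (7 + 16 * ln (real n) / (\<nu>1 * \<rho> ^ Suc h)\<^sup>2)))"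
  proof (intro add_left_mono sum_mono mult_left_mono)
    fix h
    define L where "L = 8 * ln (real n) / (\<nu>1 * \<rho> ^ Suc h)\<^sup>2 + 3"
    have "0 \<le> L" using n by (simp add: L_def)
    have "(\<Sum>p\<in>fringe h. expectation (hits p n)) \<le> (\<Sum>p\<in>fringe h. L)"
    proof (rule sum_mono)
      fix p assume p: "p \<in> fringe h"
      then have "fst p = Suc h" by (auto simp: fringe_def mem_children_iff)
      then show "expectation (hits p n) \<le> L"
        using expectation_hits[OF n, of p] p by (simp add: L_def fringe_def)
    qed
    also have "\<dots> \<le> 2 * real (card (near_nodes h)) * L"
      using card_fringe[of h] \<open>0 \<le> L\<close> by (simp add: mult_right_mono)
    finally show "real (card (near_nodes h)) + (\<Sum>p\<in>fringe h. expectation (hits p n))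
        \<le> real (card (near_nodes h)) * (7 + 16 * ln (real n) / (\<nu>1 * \<rho> ^ Suc h)\<^sup>2)"
      by (simp add: L_def algebra_simps)
    show "0 \<le> 4 * \<nu>1 * \<rho> ^ h" using constants by simp
  qed
  finally show ?thesis .
qed

end

text \<open>The sum over depths grows geometrically with ratio
  \<open>\<rho> powr (- (d + 1)) > 1\<close>, so it is of the order of its last term,
  \<open>ln (real n) * (\<rho> ^ H) powr (- (d + 1))\<close>. The prescribed
  \<open>\<rho> ^ H\<close> balances this against the cost \<open>\<rho> ^ H * real n\<close> at the
  depth limit.\<close>

lemma finite_horizon_rate:
  fixes \<rho> c d :: real and N :: "nat \<Rightarrow> real"
  assumes \<rho>: "0 < \<rho>" "\<rho> < 1" and "0 < \<nu>1" "0 < \<nu>2" "0 < c" "0 \<le> d" "0 < C"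
    and N: "\<And>h. N h \<le> C * (\<nu>2 * \<rho> ^ h) powr (- d)"
  obtains B where "B > 0" "\<And>n H. 2 \<le> n \<Longrightarrow>
    \<rho> ^ H = c * (real n / ln (real n)) powr (- (1 / (d + 2))) \<Longrightarrow>
    4 * \<nu>1 * \<rho> ^ H * real n
      + (\<Sum>h<H. 4 * \<nu>1 * \<rho> ^ h * (N h * (7 + 16 * ln (real n) / (\<nu>1 * \<rho> ^ Suc h)\<^sup>2)))
    \<le> B * (real n powr ((d + 1) / (d + 2)) * ln (real n) powr (1 / (d + 2)))"
proof -
  \<comment> \<open>\<open>7 / ln 2\<close> absorbs the constant 7 into a multiple of
    \<open>ln (real n)\<close>, as \<open>ln (real n) \<ge> ln 2\<close>.\<close>
  define D where "D = 7 / ln 2 + 16 / (\<nu>1 * \<rho>)\<^sup>2"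
  define q where "q = \<rho> powr (- (d + 1))"
  define E where "E = 4 * \<nu>1 * C * \<nu>2 powr (- d) * D"
  define B where "B = 4 * \<nu>1 * c + E * c powr (- (d + 1)) / (q - 1)"
  have D: "0 < D" using assms by (auto simp: D_def intro!: add_pos_pos)
  then have E: "0 < E" using assms by (simp add: E_def)
  have q: "1 < q"
    using powr_less_mono'[of \<rho> "- (d + 1)" 0] assms by (simp add: q_def)
  have "B > 0" using assms E q unfolding B_def by (intro add_pos_pos) auto
  moreover have "4 * \<nu>1 * \<rho> ^ H * real n
      + (\<Sum>h<H. 4 * \<nu>1 * \<rho> ^ h * (N h * (7 + 16 * ln (real n) / (\<nu>1 * \<rho> ^ Suc h)\<^sup>2)))
    \<le> B * (real n powr ((d + 1) / (d + 2)) * ln (real n) powr (1 / (d + 2)))"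
    if n: "2 \<le> n" and H: "\<rho> ^ H = c * (real n / ln (real n)) powr (- (1 / (d + 2)))" for n H
  proof -
    define w where "w = ln (real n)"
    define g where "g = real n powr ((d + 1) / (d + 2)) * w powr (1 / (d + 2))"
    have w: "ln 2 \<le> w" "0 < w" using n by (auto simp: w_def)
    have frac: "1 - 1 / (d + 2) = (d + 1) / (d + 2)" "1 - (d + 1) / (d + 2) = 1 / (d + 2)"
      using \<open>0 \<le> d\<close> by (auto simp: field_simps)
    have first: "\<rho> ^ H * real n = c * g"
    proof -
      have "real n * real n powr (- (1 / (d + 2))) = real n powr (1 - 1 / (d + 2))"
        using n by (simp add: powr_diff powr_minus divide_inverse)
      moreover have "(real n / w) powr (- (1 / (d + 2)))
          = real n powr (- (1 / (d + 2))) * w powr (1 / (d + 2))"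
        using n w by (simp add: powr_divide powr_minus field_simps)
      ultimately show ?thesis
        unfolding H g_def w_def[symmetric] frac by (simp add: mult_ac)
    qed
    \<comment> \<open>In terms of \<open>r = \<rho> ^ h\<close>, the loss contributes
      \<open>r\<close>, the number of nodes \<open>r powr (- d)\<close> and the visits
      \<open>1 / r\<^sup>2\<close>; together \<open>r powr (- (d + 1))\<close>.\<close>
    have layer: "4 * \<nu>1 * \<rho> ^ h * (N h * (7 + 16 * w / (\<nu>1 * \<rho> ^ Suc h)\<^sup>2)) \<le> E * w * q ^ h" for h
    proof -
      define r where "r = \<rho> ^ h"
      have r: "0 < r" "r \<le> 1" using \<rho> by (auto simp: r_def power_le_one)
      have "7 + 16 * w / (\<nu>1 * \<rho> ^ Suc h)\<^sup>2 \<le> D * w / r\<^sup>2"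
      proof -
        have "7 * 1 \<le> 7 * (w / ln 2)" using w by (intro mult_left_mono) (auto simp: le_divide_eq)
        also have "\<dots> \<le> 7 * (w / ln 2) / r\<^sup>2"
        proof -
          have "r\<^sup>2 \<le> 1" using r by (simp add: power_le_one)
          then show ?thesis using r w by (simp add: le_divide_eq mult_left_le)
        qed
        finally have "7 \<le> 7 * (w / ln 2) / r\<^sup>2" by simp
        moreover have "16 * w / (\<nu>1 * \<rho> ^ Suc h)\<^sup>2 = 16 / (\<nu>1 * \<rho>)\<^sup>2 * w / r\<^sup>2"
          by (simp add: r_def power_mult_distrib)
        moreover have "D * w / r\<^sup>2 = 7 * (w / ln 2) / r\<^sup>2 + 16 / (\<nu>1 * \<rho>)\<^sup>2 * w / r\<^sup>2"
          by (simp add: D_def ring_distribs add_divide_distrib)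
        ultimately show ?thesis by linarith
      qed
      then have "N h * (7 + 16 * w / (\<nu>1 * \<rho> ^ Suc h)\<^sup>2)
          \<le> (C * (\<nu>2 * r) powr (- d)) * (D * w / r\<^sup>2)"
        using N[of h] w assms by (intro mult_mono) (auto simp: r_def)
      then have "4 * \<nu>1 * r * (N h * (7 + 16 * w / (\<nu>1 * \<rho> ^ Suc h)\<^sup>2))
          \<le> 4 * \<nu>1 * r * ((C * (\<nu>2 * r) powr (- d)) * (D * w / r\<^sup>2))"
        using r assms by (intro mult_left_mono) auto
      also have "\<dots> = E * w * (r powr (- d) * (r / r\<^sup>2))"
        using r assms by (simp add: E_def powr_mult)
      also have "r powr (- d) * (r / r\<^sup>2) = r powr (- d) * r powr (- 1)"
        using r by (simp add: power2_eq_square powr_minus divide_inverse)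
      also have "\<dots> = r powr (- (d + 1))"
        by (subst powr_add[symmetric]) simp
      also have "\<dots> = q ^ h"
        using \<rho> by (simp add: r_def q_def powr_powr mult.commute flip: powr_realpow)
      finally show ?thesis by (simp add: r_def)
    qed
    have "(\<Sum>h<H. 4 * \<nu>1 * \<rho> ^ h * (N h * (7 + 16 * w / (\<nu>1 * \<rho> ^ Suc h)\<^sup>2)))
        \<le> (\<Sum>h<H. E * w * q ^ h)"
      by (intro sum_mono layer)
    also have "\<dots> = E * w * ((q ^ H - 1) / (q - 1))"
      using q by (simp add: geometric_sum flip: sum_distrib_left)
    also have "\<dots> \<le> E * w * (q ^ H / (q - 1))"
      using E w q by (intro mult_left_mono divide_right_mono) auto
    also have "q ^ H = (\<rho> ^ H) powr (- (d + 1))"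
      using \<rho> by (simp add: q_def powr_powr mult.commute flip: powr_realpow)
    also have "\<dots> = c powr (- (d + 1)) * (real n / w) powr ((d + 1) / (d + 2))"
    proof -
      have "- (1 / (d + 2)) * (- (d + 1)) = (d + 1) / (d + 2)"
        by (subst minus_mult_minus) simp
      then show ?thesis
        unfolding H w_def[symmetric] using assms n w by (simp only: powr_mult powr_powr)
    qed
    also have "E * w * (c powr (- (d + 1)) * (real n / w) powr ((d + 1) / (d + 2)) / (q - 1))
        = E * c powr (- (d + 1)) / (q - 1) * g"
    proof -
      \<comment> \<open>The leftover power of \<open>w\<close> is
        \<open>1 - (d + 1) / (d + 2) = 1 / (d + 2)\<close>, so the sum has the same order
        \<open>g\<close> as the first term.\<close>
      have "w * (real n / w) powr ((d + 1) / (d + 2)) = g"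
      proof -
        have "w / w powr ((d + 1) / (d + 2)) = w powr (1 - (d + 1) / (d + 2))"
          using w by (simp add: powr_diff)
        moreover have "w * (real n / w) powr ((d + 1) / (d + 2))
            = real n powr ((d + 1) / (d + 2)) * (w / w powr ((d + 1) / (d + 2)))"
          using n w by (simp add: powr_divide)
        ultimately show ?thesis by (simp only: g_def frac)
      qed
      moreover have "E * w * (c powr (- (d + 1)) * (real n / w) powr ((d + 1) / (d + 2)) / (q - 1))
          = E * c powr (- (d + 1)) / (q - 1) * (w * (real n / w) powr ((d + 1) / (d + 2)))"
        by simp
      ultimately show ?thesis by simp
    qed
    finally have "4 * \<nu>1 * (\<rho> ^ H * real n)
      + (\<Sum>h<H. 4 * \<nu>1 * \<rho> ^ h * (N h * (7 + 16 * w / (\<nu>1 * \<rho> ^ Suc h)\<^sup>2)))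
      \<le> 4 * \<nu>1 * (c * g) + E * c powr (- (d + 1)) / (q - 1) * g"
      unfolding first by simp
    also have "\<dots> = B * g" by (simp add: B_def ring_distribs)
    finally show ?thesis by (simp add: w_def g_def mult.assoc)
  qed
  ultimately show ?thesis using that by blast
qed

theorem corollary1:
  fixes A :: "'x measure" and K :: "'x \<Rightarrow> real measure"
    and f :: "'x \<Rightarrow> real" and xstar :: 'x
    and cell :: "nat \<Rightarrow> nat \<Rightarrow> 'x set" and l :: "'x \<Rightarrow> 'x \<Rightarrow> real"
    and \<nu>1 \<nu>2 \<rho> d c :: real
  assumes "hierarchical_bandit A K f xstar cell l \<nu>1 \<nu>2 \<rho>"
    and "has_near_opt_dim (space A) f xstar l (4 * \<nu>1 / \<nu>2) \<nu>2 d"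
    and "0 < c"
  shows "\<exists>C>0. \<forall>n\<ge>2. \<forall>H.
    \<rho> ^ H = c * (real n / ln (real n)) powr (- (1 / (d + 2))) \<longrightarrow>
    (\<forall>(M :: 'w measure) N X Y. ld_hoo M A K cell \<nu>1 \<rho> H N X Y \<longrightarrow>
      \<bar>LINT \<omega>|M. regret f xstar X n \<omega>\<bar>
        \<le> C * (real n powr ((d + 1) / (d + 2)) * ln (real n) powr (1 / (d + 2))))"
proof -
  interpret hierarchical_bandit A K f xstar cell l \<nu>1 \<nu>2 \<rho> by fact
  \<comment> \<open>The dimension is an infimum over nonnegative exponents.\<close>
  have "0 \<le> ereal d"
  proof -
    have "0 \<le> near_opt_dim (space A) f xstar l (4 * \<nu>1 / \<nu>2) \<nu>2"
      unfolding near_opt_dim_def by (rule Inf_greatest) auto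
    then show ?thesis using assms(2) by (simp add: has_near_opt_dim_def)
  qed
  then have d: "0 \<le> d" by simp
  obtain C where C: "0 < C" "\<And>\<epsilon>. 0 < \<epsilon> \<Longrightarrow> \<epsilon> \<le> \<nu>2 \<Longrightarrow>
      packing_number (space A) l (near_optimal (space A) f xstar (4 * \<nu>1 / \<nu>2 * \<epsilon>)) \<epsilon>
        \<le> ereal (C * \<epsilon> powr (- d))"
    using assms(2) unfolding has_near_opt_dim_def packing_growth_def by blast
  \<comment> \<open>\<open>B\<close> is fixed before \<open>n\<close>, \<open>H\<close> and the run
    are chosen, so the implied constant is uniform in all of them.\<close>
  obtain B where B: "0 < B" "\<And>n H. 2 \<le> n \<Longrightarrow>
    \<rho> ^ H = c * (real n / ln (real n)) powr (- (1 / (d + 2))) \<Longrightarrow>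
    4 * \<nu>1 * \<rho> ^ H * real n
      + (\<Sum>h<H. 4 * \<nu>1 * \<rho> ^ h * (real (card (near_nodes h))
          * (7 + 16 * ln (real n) / (\<nu>1 * \<rho> ^ Suc h)\<^sup>2)))
    \<le> B * (real n powr ((d + 1) / (d + 2)) * ln (real n) powr (1 / (d + 2)))"
    by (rule finite_horizon_rate[OF constants(3,4,1,2) assms(3) d C(1) card_near_nodes[OF C(2)]])
      blast+
  show ?thesis
  proof (intro exI[of _ B] conjI allI impI B(1))
    fix n H and M :: "'w measure" and N X Y
    assume n: "2 \<le> n" and H: "\<rho> ^ H = c * (real n / ln (real n)) powr (- (1 / (d + 2)))"
      and run: "ld_hoo M A K cell \<nu>1 \<rho> H N X Y"
    interpret R: ld_hoo_run A K f xstar cell l \<nu>1 \<nu>2 \<rho> M H N X Y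
      by (rule ld_hoo_run.intro[OF assms(1) run])
    have "0 \<le> (LINT \<omega>|M. regret f xstar X n \<omega>)"
      by (intro integral_nonneg_AE AE_I2 R.regret_nonneg)
    moreover have "(LINT \<omega>|M. regret f xstar X n \<omega>) \<le>
        B * (real n powr ((d + 1) / (d + 2)) * ln (real n) powr (1 / (d + 2)))"
      using R.expected_regret[OF n] B(2)[OF n H] by (rule order_trans)
    ultimately show "\<bar>LINT \<omega>|M. regret f xstar X n \<omega>\<bar>
        \<le> B * (real n powr ((d + 1) / (d + 2)) * ln (real n) powr (1 / (d + 2)))"
      by simp
  qed
qed

end
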